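(* Assume $\tau>0$. There is an algorithm for MinSet under stochastic explorable uncertainty with competitive ratio $\mathcal{O}(\frac{1}{\tau}\cdot\log m\cdot\bar\rho(\gamma))\subseteq\mathcal{O}(\frac{1}{\tau}\cdot\log^2 m)$, where $\gamma=2/s_{\min}$, $s_{\min}=\min_{I_i\in\mathcal{I}:U_i-L_i>0}(U_i-L_i)$, and $\bar\rho(\gamma)=\lceil\ln(\gamma\cdot m\cdot\max_{S,S'\in\mathcal{S}}(U_S-L_{S'}))\rceil+\lceil\ln m\rceil$.
   Context: An instance of MinSet under stochastic explorable uncertainty consists of intervals $\mathcal{I}=\{I_1,\dots,I_n\}$, each open $(L_i,U_i)$ with $L_i<U_i$ or trivial $\{w_i\}$ with $L_i=U_i=w_i$, and a family $\mathcal{S}$ of $m$ subsets of $\mathcal{I}$. Each $I_i$ has a value $w_i\in I_i$, drawn independently according to a distribution unknown to the algorithm; querying $I_i$ reveals $w_i$. For $S\in\mathcal{S}$: $w(S)=\sum_{I_i\in S}w_i$, $L_S=\sum_{I_i\in S}L_i$, $U_S=\sum_{I_i\in S}U_i$; for $Q\subseteq\mathcal{I}$, $L_S(Q)=\sum_{I_i\in S\setminus Q}L_i+\sum_{I_i\in S\cap Q}w_i$, $U_S(Q)=\sum_{I_i\in S\setminus Q}U_i+\sum_{I_i\in S\cap Q}w_i$. Let $w^*=\min_S w(S)$. A set $Q$ is feasible if some $S^*$ has $L_{S^*}(Q)=U_{S^*}(Q)=w^*$ and $L_S(Q)\ge w^*$ for all $S$. An algorithm adaptively queries until its queried set is feasible;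 $\mathrm{ALG}$ is its number of queries and $\mathrm{OPT}$ the minimum cardinality of a feasible set for the realized values; the competitive ratio is the worst case of $\mathbb{E}[\mathrm{ALG}]/\mathbb{E}[\mathrm{OPT}]$. $\tau_i=\Pr[w_i\ge(U_i+L_i)/2]$ and $\tau=\min_i\tau_i$. The constants hidden in the $\mathcal{O}$-notation may depend on the interval limits (which are regarded as constants). *)

theory Defs
  imports "HOL-Probability.Probability"
begin

text \<open>
  The intervals are indexed by \<open>{..<num I}\<close>; a subset of the intervals is a set of indices.
  This record is exactly what an algorithm knows before its first query.
\<close>

record minset =
  num :: nat
  lo :: "nat \<Rightarrow> real"
  up :: "nat \<Rightarrow> real"
  fam :: "nat set set"

definition minset_instance :: "minset \<Rightarrow> bool" where
  "minset_instance I \<longleftrightarrow>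
     (\<forall>i<num I. lo I i \<le> up I i) \<and> fam I \<noteq> {} \<and> fam I \<subseteq> Pow {..<num I}"

definition ivl :: "minset \<Rightarrow> nat \<Rightarrow> real set" where
  "ivl I i = (if lo I i < up I i then {lo I i<..<up I i} else {lo I i})"

definition lo_set :: "minset \<Rightarrow> nat set \<Rightarrow> real" where
  "lo_set I S = (\<Sum>i\<in>S. lo I i)"

definition up_set :: "minset \<Rightarrow> nat set \<Rightarrow> real" where
  "up_set I S = (\<Sum>i\<in>S. up I i)"

definition lo_after :: "minset \<Rightarrow> (nat \<Rightarrow> real) \<Rightarrow> nat set \<Rightarrow> nat set \<Rightarrow> real" where
  "lo_after I w Q S = (\<Sum>i\<in>S - Q. lo I i) + (\<Sum>i\<in>S \<inter> Q. w i)"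

definition up_after :: "minset \<Rightarrow> (nat \<Rightarrow> real) \<Rightarrow> nat set \<Rightarrow> nat set \<Rightarrow> real" where
  "up_after I w Q S = (\<Sum>i\<in>S - Q. up I i) + (\<Sum>i\<in>S \<inter> Q. w i)"

definition w_star :: "minset \<Rightarrow> (nat \<Rightarrow> real) \<Rightarrow> real" where
  "w_star I w = Min ((\<lambda>S. \<Sum>i\<in>S. w i) ` fam I)"

definition feasible :: "minset \<Rightarrow> (nat \<Rightarrow> real) \<Rightarrow> nat set \<Rightarrow> bool" where
  "feasible I w Q \<longleftrightarrow>
     (\<exists>S\<in>fam I. lo_after I w Q S = w_star I w \<and> up_after I w Q S = w_star I w) \<and>
     (\<forall>S\<in>fam I. lo_after I w Q S \<ge> w_star I w)"

definition opt :: "minset \<Rightarrow> (nat \<Rightarrow> real) \<Rightarrow> nat" where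
  "opt I w = Min (card ` {Q. Q \<subseteq> {..<num I} \<and> feasible I w Q})"

text \<open>
  An algorithm maps the known data and the history of queried indices with their revealed
  values to the next index to query.  It sees neither the distributions nor the values of
  unqueried intervals.
\<close>

type_synonym algorithm = "minset \<Rightarrow> (nat \<times> real) list \<Rightarrow> nat"

definition query_algorithm :: "algorithm \<Rightarrow> bool" where
  "query_algorithm A \<longleftrightarrow>
     (\<forall>I h. fst ` set h \<subset> {..<num I} \<longrightarrow> A I h \<in> {..<num I} - fst ` set h)"

primrec history :: "algorithm \<Rightarrow> minset \<Rightarrow> (nat \<Rightarrow> real) \<Rightarrow> nat \<Rightarrow> (nat \<times> real) list" where
  "history A I w 0 = []"
| "history A I w (Suc k) =
     (let h = history A I w k; i = A I h in h @ [(i, w i)])"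

text \<open>
  On intervals respecting their limits, feasibility of a set of queries is determined by the
  revealed values alone, so stopping at the first feasible set uses no hidden information.
  Querying all intervals is feasible, so a query algorithm makes at most \<open>num I\<close> queries.
\<close>

definition alg :: "algorithm \<Rightarrow> minset \<Rightarrow> (nat \<Rightarrow> real) \<Rightarrow> nat" where
  "alg A I w = (LEAST k. feasible I w (fst ` set (history A I w k)))"

definition value_distributions :: "minset \<Rightarrow> (nat \<Rightarrow> real measure) \<Rightarrow> bool" where
  "value_distributions I D \<longleftrightarrow>
     (\<forall>i<num I. prob_space (D i) \<and> sets (D i) = sets borel \<and> (AE x in D i. x \<in> ivl I i))"

definition joint :: "minset \<Rightarrow> (nat \<Rightarrow> real measure) \<Rightarrow> (nat \<Rightarrow> real) measure" where
  "joint I D = (\<Pi>\<^sub>M i\<in>{..<num I}. D i)"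

text \<open>
  The product form of the ratio forces the expected number of queries to be \<open>0\<close> whenever the
  expected optimum is \<open>0\<close>.  Integrability is demanded explicitly because the integral of a
  non-integrable function is \<open>0\<close> by convention.
\<close>

definition competitive ::
  "algorithm \<Rightarrow> minset \<Rightarrow> (nat \<Rightarrow> real measure) \<Rightarrow> real \<Rightarrow> bool" where
  "competitive A I D r \<longleftrightarrow>
     integrable (joint I D) (\<lambda>w. real (alg A I w)) \<and>
     (\<integral>w. real (alg A I w) \<partial>joint I D) \<le> r * (\<integral>w. real (opt I w) \<partial>joint I D)"

definition tau :: "minset \<Rightarrow> (nat \<Rightarrow> real measure) \<Rightarrow> real" where
  "tau I D = Min ((\<lambda>i. measure (D i) {x. x \<ge> (up I i + lo I i) / 2}) ` {..<num I})"

definition s_min :: "minset \<Rightarrow> real" where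
  "s_min I = Min {up I i - lo I i | i. i < num I \<and> up I i - lo I i > 0}"

definition max_gap :: "minset \<Rightarrow> real" where
  "max_gap I = Max {up_set I S - lo_set I S' | S S'. S \<in> fam I \<and> S' \<in> fam I}"

definition rho_bar :: "minset \<Rightarrow> real \<Rightarrow> real" where
  "rho_bar I \<gamma> =
     of_int (\<lceil>ln (\<gamma> * real (card (fam I)) * max_gap I)\<rceil> + \<lceil>ln (real (card (fam I)))\<rceil>)"

end

theory Submission
  imports Defs
begin

text \<open>
  On realized values, a set of queries is feasible iff it lifts the lower limit of every set of
  the family to at least \<open>w\<^sup>*\<close>, a covering problem with unknown coefficients \<open>w\<^sub>i - L\<^sub>i\<close> and unknown
  right-hand side.  For a budget \<open>B\<close>, the largest bound to which \<open>B\<close> queries could lift all lower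
  limits if the unrevealed values were \<open>U\<^sub>i\<close> is known to the algorithm, only decreases over time, and
  is at least \<open>w\<^sup>*\<close> as soon as \<open>B \<ge> OPT\<close>.  The algorithm greedily covers up to this bound, for the
  least power of two \<open>B\<close> whose bound is not yet reached; while the queries are infeasible this
  \<open>B\<close> is below \<open>2 OPT\<close>.

  Call a query successful if \<open>w\<^sub>i \<ge> (U\<^sub>i + L\<^sub>i) / 2\<close>.  A successful greedy query multiplies the
  potential by at most \<open>1 - 1 / (4 B)\<close>, so along every realization there are \<open>O(B \<rho>)\<close> successes
  for budget \<open>B\<close>, and \<open>O(OPT \<rho>)\<close> altogether.  Whether an interval is queried is independent of
  its value, so \<open>\<tau> E[ALG]\<close> is at most the expected number of successes.
\<close>

section \<open>The greedy algorithm and its potential\<close>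

definition realization :: "minset \<Rightarrow> (nat \<Rightarrow> real) \<Rightarrow> bool" where
  "realization I w \<longleftrightarrow> (\<forall>i<num I. w i \<in> ivl I i)"

definition optimistic :: "minset \<Rightarrow> (nat \<Rightarrow> real) \<Rightarrow> nat set \<Rightarrow> nat \<Rightarrow> real" where
  "optimistic I w Q i = (if i \<in> Q then w i else up I i)"

text \<open>
  The budget \<open>B\<close> includes the queries already made: \<open>P\<close> may contain elements of \<open>Q\<close>, at their
  revealed values.  This is what makes the target antitone in \<open>Q\<close>.
\<close>

definition target :: "minset \<Rightarrow> (nat \<Rightarrow> real) \<Rightarrow> nat set \<Rightarrow> nat \<Rightarrow> real" where
  "target I w Q B =
     Max ((\<lambda>P. Min (lo_after I (optimistic I w Q) P ` fam I)) ` {P. P \<subseteq> {..<num I} \<and> card P \<le> B})"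

definition deficit :: "minset \<Rightarrow> (nat \<Rightarrow> real) \<Rightarrow> nat set \<Rightarrow> nat \<Rightarrow> nat set \<Rightarrow> real" where
  "deficit I w Q B S = target I w Q B - lo_after I w Q S"

text \<open>
  The jump by \<open>s / 2\<close> at \<open>0\<close> makes the potential count uncovered sets once the deficits are small:
  a successful query covers every deficit up to \<open>s / 2\<close> completely, so nothing below that
  threshold has to be resolved.
\<close>

definition penalty :: "real \<Rightarrow> real \<Rightarrow> real" where
  "penalty s r = (if r > 0 then r + s / 2 else 0)"

definition potential :: "minset \<Rightarrow> (nat \<Rightarrow> real) \<Rightarrow> nat set \<Rightarrow> nat \<Rightarrow> real" where
  "potential I w Q B = (\<Sum>S\<in>fam I. penalty (s_min I) (deficit I w Q B S))"

text \<open>If \<open>Q\<close> is feasible, no such power of two need exist and the level may be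
  unspecified; the analysis reads it on infeasible \<open>Q\<close> only.\<close>

definition level :: "minset \<Rightarrow> (nat \<Rightarrow> real) \<Rightarrow> nat set \<Rightarrow> nat" where
  "level I w Q = (LEAST j. potential I w Q (2 ^ j) > 0)"

text \<open>The guaranteed drop of the potential in case the query of \<open>i\<close> succeeds. It
  is computable beforehand, because success raises the lower limit of each set containing
  \<open>i\<close> by at least half the width of \<open>i\<close>; see
  \<open>potential_success\<close>.\<close>

definition score :: "minset \<Rightarrow> (nat \<Rightarrow> real) \<Rightarrow> nat set \<Rightarrow> nat \<Rightarrow> nat \<Rightarrow> real" where
  "score I w Q B i =
     (\<Sum>S | S \<in> fam I \<and> i \<in> S. penalty (s_min I) (deficit I w Q B S)
        - penalty (s_min I) (deficit I w Q B S - (up I i - lo I i) / 2))"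

definition greedy_query :: "minset \<Rightarrow> (nat \<Rightarrow> real) \<Rightarrow> nat set \<Rightarrow> nat" where
  "greedy_query I w Q =
     (LEAST i. i < num I \<and> i \<notin> Q \<and>
        (\<forall>k<num I. k \<notin> Q \<longrightarrow>
           score I w Q (2 ^ level I w Q) k \<le> score I w Q (2 ^ level I w Q) i))"

text \<open>For an unqueried \<open>i\<close> the value \<open>the (map_of h i)\<close> is
  unspecified; by \<open>greedy_query_cong\<close> it never influences the choice.\<close>

definition greedy :: algorithm where
  "greedy I h = greedy_query I (\<lambda>i. the (map_of h i)) (fst ` set h)"

section \<open>The penalty of a deficit\<close>

lemma penalty_mono: "s \<ge> 0 \<Longrightarrow> x \<le> y \<Longrightarrow> penalty s x \<le> penalty s y"
  by (simp add: penalty_def)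

lemma penalty_nonneg: "s \<ge> 0 \<Longrightarrow> penalty s x \<ge> 0"
  by (simp add: penalty_def)

text \<open>Let \<open>r > 0\<close>. Either one \<open>a i / 2\<close> covers \<open>r\<close> and
  alone removes the whole penalty, or none does. In the latter case no term passes the jump at
  \<open>0\<close>, so each removes exactly \<open>a i / 2\<close>, in total at least
  \<open>r / 2\<close>. Some \<open>a i\<close> is nonzero, hence at least \<open>s\<close>, so
  \<open>r > s / 2\<close> and \<open>r / 2\<close> exceeds a quarter of the penalty.\<close>

lemma penalty_cover:
  fixes a :: "nat \<Rightarrow> real"
  assumes "finite X" "s > 0" and a: "\<And>i. i \<in> X \<Longrightarrow> a i = 0 \<or> s \<le> a i"
    and r: "r \<le> sum a X"
  shows "penalty s r / 4 \<le> (\<Sum>i\<in>X. penalty s r - penalty s (r - a i / 2))"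
proof (cases "r > 0")
  case False
  have "penalty s r \<le> 0" using False by (simp add: penalty_def)
  moreover have "penalty s r - penalty s (r - a i / 2) \<ge> 0" if "i \<in> X" for i
    using a[OF that] \<open>s > 0\<close> by (auto intro!: penalty_mono)
  then have "(\<Sum>i\<in>X. penalty s r - penalty s (r - a i / 2)) \<ge> 0" by (rule sum_nonneg)
  ultimately show ?thesis by linarith
next
  case True
  have nonneg: "penalty s r - penalty s (r - a i / 2) \<ge> 0" if "i \<in> X" for i
    using a[OF that] \<open>s > 0\<close> by (auto intro!: penalty_mono)
  show ?thesis
  proof (cases "\<exists>i\<in>X. r \<le> a i / 2")
    case True
    then obtain i where i: "i \<in> X" "r \<le> a i / 2" by blast
    have "penalty s r / 4 \<le> penalty s r - penalty s (r - a i / 2)"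
      using i \<open>s > 0\<close> by (simp add: penalty_def)
    also have "\<dots> \<le> (\<Sum>i\<in>X. penalty s r - penalty s (r - a i / 2))"
      using \<open>finite X\<close> i nonneg by (intro member_le_sum) auto
    finally show ?thesis .
  next
    case False
    have "\<exists>i\<in>X. a i \<noteq> 0"
      using r \<open>r > 0\<close> by (metis less_le_not_le order_trans sum.neutral)
    then obtain i where "i \<in> X" "s \<le> a i" using a by blast
    then have "s / 2 < r" using False by force
    then have "penalty s r / 4 \<le> r / 2" using True by (simp add: penalty_def)
    also have "\<dots> \<le> (\<Sum>i\<in>X. a i / 2)" using r by (simp flip: sum_divide_distrib)
    also have "\<dots> = (\<Sum>i\<in>X. penalty s r - penalty s (r - a i / 2))"
      using False True by (intro sum.cong) (auto simp: penalty_def)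
    finally show ?thesis .
  qed
qed

section \<open>Feasibility as covering\<close>

locale minset_problem =
  fixes I :: minset
  assumes inst: "minset_instance I"
begin

lemma fam_nonempty: "fam I \<noteq> {}"
  using inst by (simp add: minset_instance_def)

lemma finite_fam: "finite (fam I)"
  using inst by (auto simp: minset_instance_def intro: finite_subset)

lemma fam_subset: "S \<in> fam I \<Longrightarrow> S \<subseteq> {..<num I}"
  using inst by (auto simp: minset_instance_def)

lemma finite_fam_member: "S \<in> fam I \<Longrightarrow> finite S"
  using fam_subset finite_subset by blast

lemma lo_le_up: "i < num I \<Longrightarrow> lo I i \<le> up I i"
  using inst by (simp add: minset_instance_def)

lemma realization_bounds:
  assumes "realization I w" "i < num I"
  shows "lo I i \<le> w i" "w i \<le> up I i"
  using assms lo_le_up[OF assms(2)] by (auto simp: realization_def ivl_def split: if_splits)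

text \<open>Nontrivial intervals are open, so a value at the lower limit forces a trivial interval.
  This turns covering into feasibility in \<open>feasible_if_covered\<close>.\<close>

lemma realization_eq_lo:
  assumes "realization I w" "i < num I" "w i = lo I i"
  shows "up I i = lo I i"
  using assms lo_le_up[OF assms(2)] by (auto simp: realization_def ivl_def split: if_splits)

lemma lo_after_eq:
  "S \<in> fam I \<Longrightarrow> lo_after I w Q S = (\<Sum>i\<in>S. if i \<in> Q then w i else lo I i)"
  using sum.If_cases[OF finite_fam_member, of S "\<lambda>i. i \<in> Q" w "lo I"]
  by (simp add: lo_after_def Diff_eq add.commute)

lemma up_after_eq:
  "S \<in> fam I \<Longrightarrow> up_after I w Q S = (\<Sum>i\<in>S. if i \<in> Q then w i else up I i)"
  using sum.If_cases[OF finite_fam_member, of S "\<lambda>i. i \<in> Q" w "up I"]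
  by (simp add: up_after_def Diff_eq add.commute)

lemma lo_after_mono:
  assumes "realization I w" "S \<in> fam I" "Q \<subseteq> Q'"
  shows "lo_after I w Q S \<le> lo_after I w Q' S"
  unfolding lo_after_eq[OF assms(2)]
  using realization_bounds[OF assms(1)] fam_subset[OF assms(2)] assms(3)
  by (intro sum_mono) auto

lemma lo_after_le_sum:
  assumes "realization I w" "S \<in> fam I"
  shows "lo_after I w Q S \<le> sum w S"
  unfolding lo_after_eq[OF assms(2)]
  using realization_bounds[OF assms(1)] fam_subset[OF assms(2)] by (intro sum_mono) auto

lemma sum_le_up_after:
  assumes "realization I w" "S \<in> fam I"
  shows "sum w S \<le> up_after I w Q S"
  unfolding up_after_eq[OF assms(2)]
  using realization_bounds[OF assms(1)] fam_subset[OF assms(2)] by (intro sum_mono) auto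

lemma w_star_le: "S \<in> fam I \<Longrightarrow> w_star I w \<le> sum w S"
  unfolding w_star_def using finite_fam by (intro Min_le) auto

lemma w_star_attained: "\<exists>S\<in>fam I. w_star I w = sum w S"
proof -
  have "w_star I w \<in> sum w ` fam I"
    unfolding w_star_def using finite_fam fam_nonempty by (intro Min_in) auto
  then show ?thesis by auto
qed

text \<open>The right-hand side avoids \<open>w_star\<close> and so depends on revealed values only.
  Conversely, for \<open>T\<close> of minimum value, the upper limit of \<open>S\<close> is at most
  the lower limit of \<open>T\<close>, which is at most \<open>w_star\<close>, which is at most the
  value and hence the upper limit of \<open>S\<close>; all are equal. Taking \<open>S' = S\<close>
  fixes the lower limit of \<open>S\<close>.\<close>

lemma feasible_iff:
  assumes "realization I w"
  shows "feasible I w Q \<longleftrightarrow>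
    (\<exists>S\<in>fam I. \<forall>S'\<in>fam I. up_after I w Q S \<le> lo_after I w Q S')"
proof
  show "feasible I w Q \<Longrightarrow> \<exists>S\<in>fam I. \<forall>S'\<in>fam I. up_after I w Q S \<le> lo_after I w Q S'"
    unfolding feasible_def by metis
next
  assume "\<exists>S\<in>fam I. \<forall>S'\<in>fam I. up_after I w Q S \<le> lo_after I w Q S'"
  then obtain S where S: "S \<in> fam I" "\<And>S'. S' \<in> fam I \<Longrightarrow> up_after I w Q S \<le> lo_after I w Q S'"
    by blast
  obtain T where T: "T \<in> fam I" "w_star I w = sum w T" using w_star_attained by blast
  have "up_after I w Q S = w_star I w" "lo_after I w Q S = w_star I w"
    using S(2)[OF T(1)] S(2)[OF S(1)] lo_after_le_sum[OF assms T(1), of Q]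
      lo_after_le_sum[OF assms S(1), of Q] sum_le_up_after[OF assms S(1), of Q]
      w_star_le[OF S(1), of w] T(2) by linarith+
  then show "feasible I w Q" unfolding feasible_def using S by metis
qed

text \<open>For a set \<open>T\<close> of minimum value the lower limit reaches the value. Its
  unqueried members therefore sit at their lower limits, are trivial, and the upper limit of
  \<open>T\<close> agrees too.\<close>

lemma feasible_if_covered:
  assumes w: "realization I w" and cover: "\<And>S. S \<in> fam I \<Longrightarrow> w_star I w \<le> lo_after I w Q S"
  shows "feasible I w Q"
proof -
  obtain T where T: "T \<in> fam I" "w_star I w = sum w T" using w_star_attained by blast
  have eq: "lo_after I w Q T = sum w T"
    using cover[OF T(1)] lo_after_le_sum[OF w T(1), of Q] T(2) by linarith
  have "(\<Sum>i\<in>T. w i - (if i \<in> Q then w i else lo I i)) = 0"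
    using eq unfolding lo_after_eq[OF T(1)] by (simp add: sum_subtractf)
  moreover have "\<And>i. i \<in> T \<Longrightarrow> 0 \<le> w i - (if i \<in> Q then w i else lo I i)"
    using realization_bounds(1)[OF w] fam_subset[OF T(1)] by auto
  ultimately have "\<forall>i\<in>T. w i - (if i \<in> Q then w i else lo I i) = 0"
    using sum_nonneg_eq_0_iff[OF finite_fam_member[OF T(1)],
        of "\<lambda>i. w i - (if i \<in> Q then w i else lo I i)"] by simp
  then have "up_after I w Q T = sum w T"
    unfolding up_after_eq[OF T(1)]
    using realization_eq_lo[OF w] fam_subset[OF T(1)] by (intro sum.cong) force+
  then show ?thesis using T eq cover unfolding feasible_def by metis
qed

lemma feasible_all: "feasible I w {..<num I}"
proof -
  have eq: "lo_after I w {..<num I} S = sum w S" "up_after I w {..<num I} S = sum w S"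
    if "S \<in> fam I" for S
    unfolding lo_after_eq[OF that] up_after_eq[OF that]
    using fam_subset[OF that] by (auto intro!: sum.cong)
  obtain T where "T \<in> fam I" "w_star I w = sum w T" using w_star_attained by blast
  then show ?thesis unfolding feasible_def using eq w_star_le by metis
qed

lemma opt_attained: "\<exists>Q. Q \<subseteq> {..<num I} \<and> feasible I w Q \<and> card Q = opt I w"
proof -
  let ?F = "{Q. Q \<subseteq> {..<num I} \<and> feasible I w Q}"
  have "finite ?F" by (rule finite_subset[of _ "Pow {..<num I}"]) auto
  moreover have "?F \<noteq> {}" using feasible_all by auto
  ultimately have "opt I w \<in> card ` ?F" unfolding opt_def by (intro Min_in) auto
  then show ?thesis by auto
qed

lemma opt_le: "opt I w \<le> num I"
proof -
  obtain Q where "Q \<subseteq> {..<num I}" "card Q = opt I w" using opt_attained[of w] by blast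
  then show ?thesis using card_mono[of "{..<num I}" Q] by simp
qed

lemma feasible_empty_if_opt_0:
  assumes "opt I w = 0" shows "feasible I w {}"
proof -
  obtain Q where Q: "Q \<subseteq> {..<num I}" "feasible I w Q" "card Q = 0"
    using opt_attained[of w] assms by auto
  then have "Q = {}" using finite_subset[OF Q(1)] by simp
  then show ?thesis using Q(2) by simp
qed

text \<open>Guarantees that whenever some query is necessary, the minimum in \<open>s_min\<close>
  ranges over a nonempty set.\<close>

lemma nontrivial_if_infeasible:
  assumes "realization I w" "\<not> feasible I w {}"
  shows "\<exists>S\<in>fam I. \<exists>i\<in>S. lo I i < up I i"
proof (rule ccontr)
  assume "\<not> ?thesis"
  then have triv: "lo I i = up I i" if "S \<in> fam I" "i \<in> S" for S i
    using lo_le_up fam_subset that by (meson antisym_conv1 lessThan_iff subsetD linorder_not_less)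
  have "feasible I w {}"
  proof (rule feasible_if_covered[OF assms(1)])
    fix S assume S: "S \<in> fam I"
    have "w i = lo I i" if "i \<in> S" for i
      using realization_bounds[OF assms(1), of i] triv[OF S that] fam_subset[OF S] that by fastforce
    then have "sum w S = lo_after I w {} S" unfolding lo_after_eq[OF S] by simp
    then show "w_star I w \<le> lo_after I w {} S" using w_star_le[OF S, of w] by simp
  qed
  then show False using assms(2) by simp
qed

lemma max_gap_ge:
  assumes "S \<in> fam I" "S' \<in> fam I"
  shows "up_set I S - lo_set I S' \<le> max_gap I"
proof -
  have "{up_set I S - lo_set I S' | S S'. S \<in> fam I \<and> S' \<in> fam I}
      = (\<lambda>(S, S'). up_set I S - lo_set I S') ` (fam I \<times> fam I)" by auto
  then show ?thesis unfolding max_gap_def using finite_fam assms by (intro Max_ge) auto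
qed

lemma finite_budget: "finite {P. P \<subseteq> {..<num I} \<and> card P \<le> B}"
  by (rule finite_subset[of _ "Pow {..<num I}"]) auto

lemma target_attained:
  "\<exists>P. P \<subseteq> {..<num I} \<and> card P \<le> B \<and>
     (\<forall>S\<in>fam I. target I w Q B \<le> lo_after I (optimistic I w Q) P S)"
proof -
  have "{} \<in> {P. P \<subseteq> {..<num I} \<and> card P \<le> B}" by simp
  then have "target I w Q B \<in> (\<lambda>P. Min (lo_after I (optimistic I w Q) P ` fam I)) `
      {P. P \<subseteq> {..<num I} \<and> card P \<le> B}"
    unfolding target_def using finite_budget by (intro Max_in) blast+
  then obtain P where "P \<subseteq> {..<num I}" "card P \<le> B"
    "target I w Q B = Min (lo_after I (optimistic I w Q) P ` fam I)" by auto
  then show ?thesis using finite_fam by (intro exI[of _ P]) auto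
qed

lemma target_ge:
  assumes "P \<subseteq> {..<num I}" "card P \<le> B"
    and "\<And>S. S \<in> fam I \<Longrightarrow> x \<le> lo_after I (optimistic I w Q) P S"
  shows "x \<le> target I w Q B"
proof -
  have "x \<le> Min (lo_after I (optimistic I w Q) P ` fam I)"
    using assms(3) finite_fam fam_nonempty by (subst Min_ge_iff) auto
  also have "\<dots> \<le> target I w Q B"
    unfolding target_def using finite_budget assms(1,2) by (intro Max_ge) auto
  finally show ?thesis .
qed

lemma optimistic_ge:
  "realization I w \<Longrightarrow> i < num I \<Longrightarrow> w i \<le> optimistic I w Q i"
  using realization_bounds by (simp add: optimistic_def)

lemma lo_after_values_mono:
  assumes "S \<in> fam I" "\<And>i. i < num I \<Longrightarrow> v i \<le> v' i"
  shows "lo_after I v P S \<le> lo_after I v' P S"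
  unfolding lo_after_eq[OF assms(1)] using assms(2) fam_subset[OF assms(1)]
  by (intro sum_mono) auto

text \<open>An optimal feasible set is a candidate \<open>P\<close> within the budget, and
  optimistic values only overestimate the true ones.\<close>

lemma w_star_le_target:
  assumes "realization I w" "opt I w \<le> B"
  shows "w_star I w \<le> target I w Q B"
proof -
  obtain P where P: "P \<subseteq> {..<num I}" "feasible I w P" "card P = opt I w"
    using opt_attained by blast
  show ?thesis
  proof (rule target_ge[OF P(1)])
    show "card P \<le> B" using P assms by simp
    fix S assume S: "S \<in> fam I"
    have "w_star I w \<le> lo_after I w P S" using P(2) S unfolding feasible_def by blast
    also have "\<dots> \<le> lo_after I (optimistic I w Q) P S"
      using lo_after_values_mono[OF S] optimistic_ge[OF assms(1)] by blast
    finally show "w_star I w \<le> lo_after I (optimistic I w Q) P S" .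
  qed
qed

lemma target_antimono:
  assumes "realization I w" "Q \<subseteq> Q'"
  shows "target I w Q' B \<le> target I w Q B"
proof -
  obtain P where P: "P \<subseteq> {..<num I}" "card P \<le> B"
    "\<forall>S\<in>fam I. target I w Q' B \<le> lo_after I (optimistic I w Q') P S"
    using target_attained by blast
  show ?thesis
  proof (rule target_ge[OF P(1,2)])
    fix S assume S: "S \<in> fam I"
    have "lo_after I (optimistic I w Q') P S \<le> lo_after I (optimistic I w Q) P S"
      using realization_bounds[OF assms(1)] assms(2)
      by (intro lo_after_values_mono[OF S]) (auto simp: optimistic_def)
    then show "target I w Q' B \<le> lo_after I (optimistic I w Q) P S" using P(3) S by force
  qed
qed

lemma deficit_antimono:
  assumes "realization I w" "Q \<subseteq> Q'" "S \<in> fam I"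
  shows "deficit I w Q' B S \<le> deficit I w Q B S"
  unfolding deficit_def
  using target_antimono[OF assms(1,2), of B] lo_after_mono[OF assms(1,3,2)] by linarith

text \<open>Let \<open>P\<close> attain the target. In the difference of the two lower limits,
  indices in both \<open>P\<close> and \<open>Q\<close> cancel and indices outside \<open>P\<close>
  contribute at most \<open>0\<close>; what remains is \<open>P - Q\<close>, with full
  widths.\<close>

lemma deficit_cover:
  assumes w: "realization I w"
  shows "\<exists>P. P \<subseteq> {..<num I} \<and> card P \<le> B \<and>
    (\<forall>S\<in>fam I. deficit I w Q B S \<le> (\<Sum>i\<in>S \<inter> (P - Q). up I i - lo I i))"
proof -
  obtain P where P: "P \<subseteq> {..<num I}" "card P \<le> B"
    "\<forall>S\<in>fam I. target I w Q B \<le> lo_after I (optimistic I w Q) P S"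
    using target_attained by blast
  have "deficit I w Q B S \<le> (\<Sum>i\<in>S \<inter> (P - Q). up I i - lo I i)" if S: "S \<in> fam I" for S
  proof -
    have "deficit I w Q B S \<le> lo_after I (optimistic I w Q) P S - lo_after I w Q S"
      using P(3) S unfolding deficit_def by force
    also have "\<dots> = (\<Sum>i\<in>S. (if i \<in> P then optimistic I w Q i else lo I i)
                     - (if i \<in> Q then w i else lo I i))"
      unfolding lo_after_eq[OF S] by (simp add: sum_subtractf)
    also have "\<dots> \<le> (\<Sum>i\<in>S. if i \<in> P - Q then up I i - lo I i else 0)"
      using realization_bounds[OF w] fam_subset[OF S]
      by (intro sum_mono) (auto simp: optimistic_def)
    also have "\<dots> = (\<Sum>i\<in>S \<inter> (P - Q). up I i - lo I i)"
      using finite_fam_member[OF S] by (simp add: sum.inter_restrict)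
    finally show ?thesis .
  qed
  then show ?thesis using P by blast
qed

end

section \<open>Potential decrease under greedy queries\<close>

locale nontrivial_minset_problem = minset_problem +
  assumes nontrivial: "\<exists>S\<in>fam I. \<exists>i\<in>S. lo I i < up I i"
begin

lemma finite_widths: "finite {up I i - lo I i | i. i < num I \<and> up I i - lo I i > 0}"
  by (rule finite_subset[of _ "(\<lambda>i. up I i - lo I i) ` {..<num I}"]) auto

lemma s_min_pos: "s_min I > 0"
proof -
  have "{up I i - lo I i | i. i < num I \<and> up I i - lo I i > 0} \<noteq> {}"
    using nontrivial fam_subset by fastforce
  then have "s_min I \<in> {up I i - lo I i | i. i < num I \<and> up I i - lo I i > 0}"
    unfolding s_min_def using finite_widths by (intro Min_in)
  then show ?thesis by auto
qed

lemma s_min_le: "i < num I \<Longrightarrow> lo I i < up I i \<Longrightarrow> s_min I \<le> up I i - lo I i"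
  unfolding s_min_def using finite_widths by (intro Min_le) auto

lemma width_cases: "i < num I \<Longrightarrow> up I i - lo I i = 0 \<or> s_min I \<le> up I i - lo I i"
  using s_min_le[of i] lo_le_up[of i] by fastforce

lemma potential_antimono:
  assumes "realization I w" "Q \<subseteq> Q'"
  shows "potential I w Q' B \<le> potential I w Q B"
  unfolding potential_def using deficit_antimono[OF assms] s_min_pos
  by (intro sum_mono penalty_mono) auto

lemma potential_ge_if_deficit:
  assumes "S \<in> fam I" "deficit I w Q B S > 0"
  shows "potential I w Q B \<ge> s_min I / 2"
proof -
  have "s_min I / 2 \<le> penalty (s_min I) (deficit I w Q B S)"
    using assms(2) by (simp add: penalty_def)
  also have "\<dots> \<le> potential I w Q B"
    unfolding potential_def using finite_fam assms(1) s_min_pos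
    by (intro member_le_sum penalty_nonneg) auto
  finally show ?thesis .
qed

text \<open>The potential skips all values strictly between \<open>0\<close> and
  \<open>s_min I / 2\<close>. This floor stops the geometric decay after logarithmically many
  factors.\<close>

lemma potential_ge_if_pos:
  assumes "potential I w Q B > 0"
  shows "potential I w Q B \<ge> s_min I / 2"
proof -
  have "\<exists>S\<in>fam I. deficit I w Q B S > 0"
  proof (rule ccontr)
    assume "\<not> ?thesis"
    then have "potential I w Q B = 0" unfolding potential_def by (auto simp: penalty_def)
    then show False using assms by simp
  qed
  then show ?thesis using potential_ge_if_deficit by blast
qed

text \<open>Averaging: by \<open>penalty_cover\<close>, the drops from indices in
  \<open>S \<inter> (P - Q)\<close> add up to a quarter of the penalty of \<open>S\<close>. After
  summing over \<open>S\<close> and exchanging the sums, the scores of \<open>P - Q\<close>, at most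
  \<open>B\<close> indices, add up to at least a quarter of the potential.\<close>

lemma best_score:
  assumes w: "realization I w" and pos: "potential I w Q B > 0"
  shows "\<exists>i<num I. i \<notin> Q \<and> potential I w Q B \<le> 4 * real B * score I w Q B i"
proof -
  let ?s = "s_min I" and ?a = "\<lambda>i. up I i - lo I i" and ?d = "deficit I w Q B"
  obtain P where P: "P \<subseteq> {..<num I}" "card P \<le> B"
    "\<forall>S\<in>fam I. ?d S \<le> (\<Sum>i\<in>S \<inter> (P - Q). ?a i)"
    using deficit_cover[OF w, of B Q] by blast
  let ?g = "\<lambda>S i. penalty ?s (?d S) - penalty ?s (?d S - ?a i / 2)"
  have finP: "finite P" using P(1) finite_subset by blast
  have "potential I w Q B / 4 = (\<Sum>S\<in>fam I. penalty ?s (?d S) / 4)"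
    by (simp add: potential_def sum_divide_distrib)
  also have "\<dots> \<le> (\<Sum>S\<in>fam I. \<Sum>i\<in>S \<inter> (P - Q). ?g S i)"
    using P finP width_cases s_min_pos by (intro sum_mono penalty_cover) auto
  also have "\<dots> = (\<Sum>S\<in>fam I. \<Sum>i | i \<in> P - Q \<and> i \<in> S. ?g S i)"
    by (intro sum.cong) auto
  also have "\<dots> = (\<Sum>i\<in>P - Q. score I w Q B i)"
    unfolding score_def using finite_fam finP by (subst sum.swap_restrict) auto
  finally have le: "potential I w Q B / 4 \<le> (\<Sum>i\<in>P - Q. score I w Q B i)" .
  show ?thesis
  proof (rule ccontr)
    assume no: "\<not> ?thesis"
    have lt: "4 * real B * score I w Q B i < potential I w Q B" if "i \<in> P - Q" for i
      using no that P(1) by force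
    have ne: "P - Q \<noteq> {}"
    proof
      assume "P - Q = {}"
      then have "(\<Sum>i\<in>P - Q. score I w Q B i) = 0" by (simp only: sum.empty)
      then show False using le pos by linarith
    qed
    have B: "real (card (P - Q)) \<le> real B"
      using P(2) finP card_mono[of P "P - Q"] by simp
    have "real B > 0" using B ne finP by (metis card_gt_0_iff finite_Diff of_nat_0_less_iff order_less_le_trans)
    then have "score I w Q B i < potential I w Q B / (4 * real B)" if "i \<in> P - Q" for i
      using lt[OF that] by (simp add: field_simps)
    then have "(\<Sum>i\<in>P - Q. score I w Q B i) < (\<Sum>i\<in>P - Q. potential I w Q B / (4 * real B))"
      using ne finP by (intro sum_strict_mono) auto
    also have "\<dots> = real (card (P - Q)) * (potential I w Q B / (4 * real B))" by simp
    also have "\<dots> \<le> real B * (potential I w Q B / (4 * real B))"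
      using B pos by (intro mult_right_mono) auto
    also have "\<dots> = potential I w Q B / 4" using \<open>real B > 0\<close> by simp
    finally show False using le by simp
  qed
qed

text \<open>Every \<open>S\<close> containing \<open>i\<close> gains \<open>w i - lo I i\<close>, at
  least half the width, while the target does not grow. The score is the loss of potential for a
  gain of exactly half the width.\<close>

lemma potential_success:
  assumes w: "realization I w" and i: "i \<notin> Q" "i < num I" "w i \<ge> (up I i + lo I i) / 2"
  shows "potential I w (insert i Q) B \<le> potential I w Q B - score I w Q B i"
proof -
  let ?s = "s_min I" and ?a = "up I i - lo I i" and ?d = "deficit I w Q B"
  have "deficit I w (insert i Q) B S \<le> ?d S - (if i \<in> S then ?a / 2 else 0)" if S: "S \<in> fam I" for S
  proof -
    have "lo_after I w (insert i Q) S - lo_after I w Q S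
        = (\<Sum>k\<in>S. (if k \<in> insert i Q then w k else lo I k) - (if k \<in> Q then w k else lo I k))"
      unfolding lo_after_eq[OF S] by (simp add: sum_subtractf)
    also have "\<dots> = (\<Sum>k\<in>S. if k = i then w i - lo I i else 0)"
      using i(1) by (intro sum.cong) auto
    also have "\<dots> = (if i \<in> S then w i - lo I i else 0)"
      using finite_fam_member[OF S] by simp
    finally have "lo_after I w (insert i Q) S - lo_after I w Q S \<ge> (if i \<in> S then ?a / 2 else 0)"
      using i(3) by (auto simp: field_simps)
    then show ?thesis
      using target_antimono[OF w subset_insertI, of i Q B] unfolding deficit_def by linarith
  qed
  then have "potential I w (insert i Q) B \<le>
      (\<Sum>S\<in>fam I. penalty ?s (?d S - (if i \<in> S then ?a / 2 else 0)))"
    unfolding potential_def using s_min_pos by (intro sum_mono penalty_mono) auto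
  also have "\<dots> = (\<Sum>S\<in>fam I. penalty ?s (?d S) -
      (if i \<in> S then penalty ?s (?d S) - penalty ?s (?d S - ?a / 2) else 0))"
    by (intro sum.cong) auto
  also have "\<dots> = potential I w Q B - score I w Q B i"
    unfolding potential_def score_def sum_subtractf
    using finite_fam by (simp add: sum.inter_filter[symmetric] sum_subtractf)
  finally show ?thesis .
qed

lemma s_min_le_max_gap: "s_min I \<le> max_gap I"
proof -
  obtain S i where S: "S \<in> fam I" "i \<in> S" "lo I i < up I i" using nontrivial by blast
  have "s_min I \<le> up I i - lo I i" using s_min_le S fam_subset by blast
  also have "\<dots> \<le> (\<Sum>i\<in>S. up I i - lo I i)"
    using S finite_fam_member lo_le_up fam_subset by (intro member_le_sum) force+
  also have "\<dots> = up_set I S - lo_set I S" by (simp add: up_set_def lo_set_def sum_subtractf)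
  finally show ?thesis using max_gap_ge[OF S(1) S(1)] by simp
qed

text \<open>Deficits are largest before any query, where they are at most
  \<open>up_set I S - lo_set I S\<close>. The jump \<open>s_min I / 2\<close> is also below
  \<open>max_gap I\<close>, hence the factor \<open>2\<close>.\<close>

lemma potential_le:
  assumes w: "realization I w"
  shows "potential I w Q B \<le> 2 * real (card (fam I)) * max_gap I"
proof -
  have d: "deficit I w Q B S \<le> max_gap I" if S: "S \<in> fam I" for S
  proof -
    obtain P where P: "target I w {} B \<le> lo_after I (optimistic I w {}) P S"
      using target_attained S by blast
    have "deficit I w Q B S \<le> deficit I w {} B S" using deficit_antimono[OF w _ S] by simp
    also have "\<dots> \<le> up_set I S - lo_set I S"
    proof -
      have "lo_after I (optimistic I w {}) P S \<le> up_set I S"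
        unfolding lo_after_eq[OF S] up_set_def using lo_le_up fam_subset[OF S]
        by (intro sum_mono) (auto simp: optimistic_def)
      moreover have "lo_after I w {} S = lo_set I S" by (simp add: lo_after_def lo_set_def)
      ultimately show ?thesis using P unfolding deficit_def by linarith
    qed
    also have "\<dots> \<le> max_gap I" using max_gap_ge[OF S S] .
    finally show ?thesis .
  qed
  have "potential I w Q B \<le> (\<Sum>S\<in>fam I. 2 * max_gap I)"
    unfolding potential_def using d s_min_le_max_gap s_min_pos
    by (intro sum_mono) (force simp: penalty_def)
  then show ?thesis by simp
qed

end

section \<open>Counting steps of geometric decay\<close>

lemma geometric_decay:
  fixes p :: "nat \<Rightarrow> real"
  assumes mono: "\<And>k. p (Suc k) \<le> p k" and decay: "\<And>k. k \<in> K \<Longrightarrow> p (Suc k) \<le> q * p k"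
    and "q \<ge> 0" "p 0 \<le> b"
  shows "p k \<le> q ^ card (K \<inter> {..<k}) * b"
proof (induction k)
  case 0
  then show ?case using assms by simp
next
  case (Suc k)
  show ?case
  proof (cases "k \<in> K")
    case True
    then have "K \<inter> {..<Suc k} = insert k (K \<inter> {..<k})" by auto
    then have "card (K \<inter> {..<Suc k}) = Suc (card (K \<inter> {..<k}))" by simp
    then show ?thesis
      using decay[OF True] mult_left_mono[OF Suc.IH \<open>q \<ge> 0\<close>] by (simp add: mult.assoc)
  next
    case False
    then have "K \<inter> {..<Suc k} = K \<inter> {..<k}" by (auto simp: less_Suc_eq)
    then show ?thesis using mono[of k] Suc.IH by simp
  qed
qed

text \<open>Just before the last step of \<open>K\<close> the value is still at least
  \<open>a\<close>, although all other steps of \<open>K\<close> have shrunk it. The last step may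
  go below \<open>a\<close> and accounts for the summand \<open>1\<close>.\<close>

lemma card_decay_steps_le:
  fixes p :: "nat \<Rightarrow> real" and B :: real
  assumes "finite K" and mono: "\<And>k. p (Suc k) \<le> p k"
    and decay: "\<And>k. k \<in> K \<Longrightarrow> p (Suc k) \<le> (1 - 1 / (4 * B)) * p k"
    and "B \<ge> 1" "p 0 \<le> b" "0 < a" "a \<le> b" and lower: "\<And>k. k \<in> K \<Longrightarrow> a \<le> p k"
  shows "real (card K) \<le> 1 + 4 * B * ln (b / a)"
proof (cases "K = {}")
  case True
  then show ?thesis using assms by (simp add: add_nonneg_nonneg)
next
  case False
  define k where "k = Max K"
  have k: "k \<in> K" "\<And>x. x \<in> K \<Longrightarrow> x \<le> k" using False \<open>finite K\<close> by (auto simp: k_def)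
  define N where "N = card (K \<inter> {..<k})"
  have "K = insert k (K \<inter> {..<k})" using k by (auto simp: order.strict_iff_order)
  then have N: "card K = Suc N"
    using \<open>finite K\<close> unfolding N_def by (metis Int_iff card_insert_disjoint finite_Int lessThan_iff less_irrefl)
  have q: "0 \<le> 1 - 1 / (4 * B)" using \<open>B \<ge> 1\<close> by (simp add: field_simps)
  have "1 - 1 / (4 * B) \<le> exp (- (1 / (4 * B)))" using exp_ge_add_one_self[of "- (1 / (4 * B))"] by simp
  then have "(1 - 1 / (4 * B)) ^ N \<le> exp (- (1 / (4 * B))) ^ N" using q by (rule power_mono)
  also have "\<dots> = exp (- (real N / (4 * B)))" by (simp flip: exp_of_nat_mult)
  finally have pow: "(1 - 1 / (4 * B)) ^ N \<le> exp (- (real N / (4 * B)))" .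
  have "a \<le> p k" using lower k by blast
  also have "p k \<le> (1 - 1 / (4 * B)) ^ N * b"
    unfolding N_def using geometric_decay[OF mono decay q \<open>p 0 \<le> b\<close>] by blast
  also have "\<dots> \<le> exp (- (real N / (4 * B))) * b"
    using pow assms by (intro mult_right_mono) auto
  finally have "exp (real N / (4 * B)) \<le> b / a"
    using assms by (simp add: exp_minus field_simps)
  then have "real N / (4 * B) \<le> ln (b / a)"
    using assms by (subst ln_ge_iff) auto
  then have "real N \<le> 4 * B * ln (b / a)" using \<open>B \<ge> 1\<close> by (simp add: field_simps)
  then show ?thesis using N by simp
qed

section \<open>Runs of an algorithm\<close>

abbreviation queried :: "algorithm \<Rightarrow> minset \<Rightarrow> (nat \<Rightarrow> real) \<Rightarrow> nat \<Rightarrow> nat set" where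
  "queried A I w k \<equiv> fst ` set (history A I w k)"

abbreviation next_query :: "algorithm \<Rightarrow> minset \<Rightarrow> (nat \<Rightarrow> real) \<Rightarrow> nat \<Rightarrow> nat" where
  "next_query A I w k \<equiv> A I (history A I w k)"

definition asked :: "algorithm \<Rightarrow> minset \<Rightarrow> (nat \<Rightarrow> real) \<Rightarrow> nat set" where
  "asked A I w = queried A I w (alg A I w)"

text \<open>Given \<open>w\<close>, a run is recorded by its list of indices alone. These lists form
  a countable type, which \<open>measurable_queries\<close> exploits.\<close>

lemma history_eq_map: "history A I w k = map (\<lambda>i. (i, w i)) (map fst (history A I w k))"
proof (induction k)
  case 0
  then show ?case by simp
next
  case (Suc k)
  show ?case unfolding history.simps Let_def map_append
    by (subst Suc.IH[symmetric]) simp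
qed

lemma queried_Suc: "queried A I w (Suc k) = insert (next_query A I w k) (queried A I w k)"
  by (simp add: Let_def)

lemma queried_eq_image: "queried A I w k = next_query A I w ` {..<k}"
  by (induction k) (auto simp: Let_def lessThan_Suc)

lemma queried_subset_card:
  assumes "query_algorithm A" "k \<le> num I"
  shows "queried A I w k \<subseteq> {..<num I} \<and> card (queried A I w k) = k"
  using assms(2)
proof (induction k)
  case 0
  then show ?case by simp
next
  case (Suc k)
  then have IH: "queried A I w k \<subseteq> {..<num I}" "card (queried A I w k) = k" by auto
  then have "queried A I w k \<subset> {..<num I}" using Suc.prems by auto
  then have "next_query A I w k \<in> {..<num I} - queried A I w k"
    using assms(1) unfolding query_algorithm_def by blast
  then show ?case using IH unfolding queried_Suc by simp
qed

context minset_problem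
begin

lemma queried_num:
  assumes "query_algorithm A"
  shows "queried A I w (num I) = {..<num I}"
  using queried_subset_card[OF assms, of "num I" I w]
  by (intro card_subset_eq) auto

lemma alg_le: "query_algorithm A \<Longrightarrow> alg A I w \<le> num I"
  unfolding alg_def using queried_num feasible_all by (intro Least_le) simp

lemma feasible_asked:
  assumes "query_algorithm A"
  shows "feasible I w (asked A I w)"
  unfolding asked_def alg_def
  using queried_num[OF assms, of w] feasible_all[of w]
  by (intro LeastI[of "\<lambda>k. feasible I w (queried A I w k)" "num I"]) simp

lemma infeasible_before_alg: "k < alg A I w \<Longrightarrow> \<not> feasible I w (queried A I w k)"
  unfolding alg_def by (rule not_less_Least)

lemma asked_eq_image: "asked A I w = next_query A I w ` {..<alg A I w}"
  unfolding asked_def by (rule queried_eq_image)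

lemma asked_subset_card:
  assumes "query_algorithm A"
  shows "asked A I w \<subseteq> {..<num I}" "card (asked A I w) = alg A I w"
  using queried_subset_card[OF assms alg_le[OF assms, of w], of w] by (simp_all add: asked_def)

lemma inj_on_next_query:
  assumes "query_algorithm A"
  shows "inj_on (next_query A I w) {..<alg A I w}"
  using asked_subset_card(2)[OF assms, of w] unfolding asked_eq_image by (intro eq_card_imp_inj_on) auto

lemma opt_0_if_alg_0:
  assumes "query_algorithm A" "alg A I w = 0"
  shows "opt I w = 0"
proof -
  have "feasible I w {}" using feasible_asked[OF assms(1), of w] assms(2) by (simp add: asked_def)
  moreover have "finite {Q. Q \<subseteq> {..<num I} \<and> feasible I w Q}"
    by (rule finite_subset[of _ "Pow {..<num I}"]) auto
  ultimately have "opt I w \<le> card ({}::nat set)"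
    unfolding opt_def by (intro Min_le imageI finite_imageI) auto
  then show ?thesis by simp
qed

end

section \<open>The greedy rule as a query algorithm\<close>

lemma greedy_query_cong:
  assumes "\<And>i. i \<in> Q \<Longrightarrow> w i = w' i"
  shows "greedy_query I w Q = greedy_query I w' Q"
proof -
  have "optimistic I w Q = optimistic I w' Q" using assms by (auto simp: optimistic_def)
  moreover have "lo_after I w Q = lo_after I w' Q"
    using assms by (auto simp: lo_after_def fun_eq_iff intro!: sum.cong)
  ultimately have d: "deficit I w Q = deficit I w' Q"
    unfolding deficit_def target_def by metis
  then have "score I w Q = score I w' Q" "level I w Q = level I w' Q"
    by (simp_all add: score_def level_def potential_def fun_eq_iff)
  then show ?thesis by (simp add: greedy_query_def)
qed

lemma greedy_map: "greedy I (map (\<lambda>i. (i, w i)) is) = greedy_query I w (set is)"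
proof -
  have "map_of (map (\<lambda>i. (i, w i)) is) i = Some (w i)" if "i \<in> set is" for i
    using that by (simp add: map_of_map_restrict)
  then show ?thesis unfolding greedy_def
    by (subst greedy_query_cong[where w' = w]) (auto simp: image_image)
qed

lemma next_query_greedy:
  "next_query greedy I w k = greedy_query I w (queried greedy I w k)"
  by (subst history_eq_map, subst greedy_map) simp

lemma greedy_query_spec:
  assumes "\<not> {..<num I} \<subseteq> Q"
  shows "greedy_query I w Q < num I" "greedy_query I w Q \<notin> Q"
    "\<And>k. k < num I \<Longrightarrow> k \<notin> Q \<Longrightarrow>
       score I w Q (2 ^ level I w Q) k \<le> score I w Q (2 ^ level I w Q) (greedy_query I w Q)"
proof -
  let ?s = "score I w Q (2 ^ level I w Q)" and ?X = "{..<num I} - Q"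
  have "Max (?s ` ?X) \<in> ?s ` ?X" using assms by (intro Max_in) auto
  then obtain i where i: "i \<in> ?X" "?s i = Max (?s ` ?X)" by auto
  have "\<exists>i. i < num I \<and> i \<notin> Q \<and> (\<forall>k<num I. k \<notin> Q \<longrightarrow> ?s k \<le> ?s i)"
    using i by (intro exI[of _ i]) auto
  from LeastI_ex[OF this, folded greedy_query_def]
  show "greedy_query I w Q < num I" "greedy_query I w Q \<notin> Q"
    "\<And>k. k < num I \<Longrightarrow> k \<notin> Q \<Longrightarrow> ?s k \<le> ?s (greedy_query I w Q)" by auto
qed

lemma query_algorithm_greedy: "query_algorithm greedy"
  unfolding query_algorithm_def greedy_def
proof (intro allI impI)
  fix I :: minset and h :: "(nat \<times> real) list"
  assume "fst ` set h \<subset> {..<num I}"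
  then have "\<not> {..<num I} \<subseteq> fst ` set h" by blast
  then show "greedy_query I (\<lambda>i. the (map_of h i)) (fst ` set h) \<in> {..<num I} - fst ` set h"
    using greedy_query_spec(1,2) by simp
qed

section \<open>Successes charged to one budget\<close>

context nontrivial_minset_problem
begin

lemma potential_pos_if_infeasible:
  assumes w: "realization I w" and "\<not> feasible I w Q" "opt I w \<le> B"
  shows "potential I w Q B > 0"
proof -
  obtain S where S: "S \<in> fam I" "lo_after I w Q S < w_star I w"
    using feasible_if_covered[OF w] assms(2) by (meson not_le)
  then have "deficit I w Q B S > 0"
    using w_star_le_target[OF w assms(3), of Q] by (simp add: deficit_def)
  then have "potential I w Q B \<ge> s_min I / 2" using potential_ge_if_deficit S(1) by blast
  then show ?thesis using s_min_pos by linarith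
qed

text \<open>Every power of two that is at least \<open>opt I w\<close> has positive potential, so
  the least exponent exists and is at most \<open>J\<close>.\<close>

lemma level_le:
  assumes "realization I w" "\<not> feasible I w Q" "opt I w \<le> 2 ^ J"
  shows "level I w Q \<le> J" "potential I w Q (2 ^ level I w Q) > 0"
  unfolding level_def
  using Least_le[of "\<lambda>j. potential I w Q (2 ^ j) > 0", OF potential_pos_if_infeasible[OF assms]]
    LeastI[of "\<lambda>j. potential I w Q (2 ^ j) > 0", OF potential_pos_if_infeasible[OF assms]]
  by simp_all

lemma greedy_progress:
  assumes w: "realization I w" and Q: "\<not> feasible I w Q" "Q \<subseteq> {..<num I}"
    and succ: "w (greedy_query I w Q) \<ge> (up I (greedy_query I w Q) + lo I (greedy_query I w Q)) / 2"
  shows "potential I w (insert (greedy_query I w Q) Q) (2 ^ level I w Q)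
    \<le> (1 - 1 / (4 * 2 ^ level I w Q)) * potential I w Q (2 ^ level I w Q)"
proof -
  let ?i = "greedy_query I w Q" and ?B = "2 ^ level I w Q :: nat"
  \<comment> \<open>A crude power of two suffices here: it only shows that the level is well
    defined.\<close>
  have "opt I w \<le> 2 ^ opt I w" by (simp add: less_imp_le)
  then have pos: "potential I w Q ?B > 0" using level_le[OF w Q(1)] by blast
  have new: "\<not> {..<num I} \<subseteq> Q" using Q feasible_all by (metis subset_antisym)
  obtain k where k: "k < num I" "k \<notin> Q" "potential I w Q ?B \<le> 4 * real ?B * score I w Q ?B k"
    using best_score[OF w pos] by blast
  have "4 * real ?B * score I w Q ?B k \<le> 4 * real ?B * score I w Q ?B ?i"
    using greedy_query_spec(3)[OF new k(1,2)] by (intro mult_left_mono) auto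
  then have "potential I w Q ?B \<le> 4 * real ?B * score I w Q ?B ?i"
    using k(3) by linarith
  then have "potential I w Q ?B / (4 * 2 ^ level I w Q) \<le> score I w Q ?B ?i"
    by (simp add: divide_le_eq mult_ac)
  moreover have "potential I w (insert ?i Q) ?B \<le> potential I w Q ?B - score I w Q ?B ?i"
    using potential_success[OF w _ _ succ] greedy_query_spec[OF new] by blast
  ultimately show ?thesis by (simp add: algebra_simps)
qed

text \<open>The potential of the fixed budget \<open>2 ^ j\<close> is followed along the whole run.
  It never increases, also at steps of other levels; each success at level \<open>j\<close> shrinks
  it by the factor of \<open>greedy_progress\<close>, and before each such step it is at least
  \<open>s_min I / 2\<close>.\<close>

lemma card_successes_level_le:
  assumes w: "realization I w"
  shows "real (card {k. k < alg greedy I w \<and> level I w (queried greedy I w k) = j \<and>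
      w (next_query greedy I w k) \<ge> (up I (next_query greedy I w k) + lo I (next_query greedy I w k)) / 2})
    \<le> 1 + 4 * 2 ^ j * ln (2 * real (card (fam I)) * max_gap I / (s_min I / 2))"
    (is "real (card ?K) \<le> _")
proof (rule card_decay_steps_le[where p = "\<lambda>k. potential I w (queried greedy I w k) (2 ^ j)"])
  show "finite ?K" by (rule finite_subset[of _ "{..<alg greedy I w}"]) auto
  show "potential I w (queried greedy I w (Suc k)) (2 ^ j) \<le> potential I w (queried greedy I w k) (2 ^ j)" for k
    using potential_antimono[OF w] unfolding queried_Suc by blast
  show "potential I w (queried greedy I w 0) (2 ^ j) \<le> 2 * real (card (fam I)) * max_gap I"
    using potential_le[OF w] .
  have "card (fam I) > 0" using finite_fam fam_nonempty by (simp add: card_gt_0_iff)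
  then have "1 * s_min I \<le> 2 * real (card (fam I)) * max_gap I"
    using s_min_le_max_gap s_min_pos by (intro mult_mono) auto
  then show "s_min I / 2 \<le> 2 * real (card (fam I)) * max_gap I" "0 < s_min I / 2"
    using s_min_pos by auto
  show "(1::real) \<le> 2 ^ j" by simp
  fix k assume "k \<in> ?K"
  then have k: "k < alg greedy I w" and lev: "level I w (queried greedy I w k) = j"
    and succ: "w (next_query greedy I w k) \<ge>
      (up I (next_query greedy I w k) + lo I (next_query greedy I w k)) / 2" by auto
  have inf: "\<not> feasible I w (queried greedy I w k)" using infeasible_before_alg k by blast
  have sub: "queried greedy I w k \<subseteq> {..<num I}"
    using queried_subset_card[OF query_algorithm_greedy] alg_le[OF query_algorithm_greedy, of w] k
    by (meson less_imp_le order_trans)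
  show "potential I w (queried greedy I w (Suc k)) (2 ^ j)
      \<le> (1 - 1 / (4 * 2 ^ j)) * potential I w (queried greedy I w k) (2 ^ j)"
    using greedy_progress[OF w inf sub] succ lev unfolding queried_Suc next_query_greedy by metis
  have "opt I w \<le> 2 ^ opt I w" by (simp add: less_imp_le)
  then have "potential I w (queried greedy I w k) (2 ^ j) > 0"
    using level_le(2)[OF w inf] lev by blast
  then show "s_min I / 2 \<le> potential I w (queried greedy I w k) (2 ^ j)"
    by (rule potential_ge_if_pos)
qed

end

section \<open>Successes over all budgets\<close>

lemma ex_power_of_2_ivl:
  assumes "n \<ge> 1"
  shows "\<exists>J. n \<le> 2 ^ J \<and> 2 ^ J < 2 * (n::nat)"
proof -
  define J where "J = (LEAST J. n \<le> 2 ^ J)"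
  have "n \<le> 2 ^ n" by (simp add: less_imp_le)
  then have J: "n \<le> 2 ^ J" unfolding J_def by (rule LeastI)
  have "2 ^ J < 2 * n"
  proof (cases J)
    case 0
    then show ?thesis using assms by simp
  next
    case (Suc j)
    then have "\<not> n \<le> 2 ^ j" unfolding J_def by (intro not_less_Least) simp
    then show ?thesis using Suc by simp
  qed
  then show ?thesis using J by blast
qed

definition successes :: "algorithm \<Rightarrow> minset \<Rightarrow> (nat \<Rightarrow> real) \<Rightarrow> nat set" where
  "successes A I w = {i \<in> asked A I w. w i \<ge> (up I i + lo I i) / 2}"

context nontrivial_minset_problem
begin

text \<open>With \<open>?x\<close> the argument of the first logarithm of \<open>rho_bar\<close>,
  the potential starts at most a factor \<open>2 * ?x\<close> above its floor. The extra
  \<open>ln 2\<close> is absorbed by \<open>ln ?m\<close>, as \<open>?m \<ge> 2\<close>.\<close>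

lemma rho_bar_ge:
  assumes "card (fam I) \<ge> 2"
  shows "1 \<le> rho_bar I (2 / s_min I)"
    "ln (2 * real (card (fam I)) * max_gap I / (s_min I / 2)) \<le> rho_bar I (2 / s_min I)"
    "0 \<le> ln (2 * real (card (fam I)) * max_gap I / (s_min I / 2))"
proof -
  let ?m = "real (card (fam I))" and ?x = "2 / s_min I * real (card (fam I)) * max_gap I"
  have m: "?m \<ge> 2" using assms by linarith
  \<comment> \<open>This gives \<open>?x \<ge> 4\<close>, which exceeds Euler's number; so
    \<open>rho_bar\<close> is at least \<open>1\<close> and can absorb additive constants.\<close>
  have "2 \<le> 2 / s_min I * max_gap I"
    using s_min_pos s_min_le_max_gap by (simp add: field_simps)
  then have "2 * 2 \<le> ?m * (2 / s_min I * max_gap I)" using m by (intro mult_mono) auto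
  then have x: "?x \<ge> 4" by (simp add: mult_ac)
  have "exp 1 \<le> (3::real)" by (rule exp_le)
  then have lnx: "ln ?x \<ge> 1" using x by (subst ln_ge_iff) linarith+
  have rho: "ln ?x + ln ?m \<le> rho_bar I (2 / s_min I)"
    unfolding rho_bar_def of_int_add by (intro add_mono le_of_int_ceiling)
  have lnm: "ln ?m \<ge> ln 2" using m by simp
  have "2 * ?m * max_gap I / (s_min I / 2) = 2 * ?x" by simp
  moreover have "ln (2 * ?x) = ln 2 + ln ?x" using x by (intro ln_mult_pos) linarith+
  ultimately have eq: "ln (2 * ?m * max_gap I / (s_min I / 2)) = ln 2 + ln ?x" by (rule trans[OF arg_cong])
  have ln2: "ln 2 > (0::real)" by simp
  show "1 \<le> rho_bar I (2 / s_min I)" using rho lnx lnm ln2 by linarith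
  show "ln (2 * ?m * max_gap I / (s_min I / 2)) \<le> rho_bar I (2 / s_min I)"
    unfolding eq using rho lnm by linarith
  show "0 \<le> ln (2 * ?m * max_gap I / (s_min I / 2))" unfolding eq using lnx ln2 by linarith
qed

text \<open>The constant is \<open>20 = 5 * 4\<close>: level \<open>j\<close> has at most
  \<open>1 + 4 * 2 ^ j * L \<le> 2 ^ j * (5 * ?rho)\<close> successes, and the powers of two up to
  \<open>2 ^ J < 2 * opt I w\<close> sum to less than \<open>4 * opt I w\<close>.\<close>

lemma card_successes_le_nontrivial:
  assumes w: "realization I w" and m: "card (fam I) \<ge> 2" and opt: "opt I w \<ge> 1"
  shows "real (card (successes greedy I w)) \<le> 20 * rho_bar I (2 / s_min I) * real (opt I w)"
proof -
  let ?q = "next_query greedy I w" and ?n = "alg greedy I w" and ?rho = "rho_bar I (2 / s_min I)"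
  define L where "L = ln (2 * real (card (fam I)) * max_gap I / (s_min I / 2))"
  define K where "K j = {k. k < ?n \<and> level I w (queried greedy I w k) = j \<and>
      w (?q k) \<ge> (up I (?q k) + lo I (?q k)) / 2}" for j
  have K: "real (card (K j)) \<le> 1 + 4 * 2 ^ j * L" for j
    unfolding K_def L_def by (rule card_successes_level_le[OF w])
  have L: "L \<ge> 0" "L \<le> ?rho" and rho: "1 \<le> ?rho" using rho_bar_ge[OF m] by (auto simp: L_def)
  obtain J where J: "opt I w \<le> 2 ^ J" "2 ^ J < 2 * opt I w"
    using ex_power_of_2_ivl[OF opt] by blast
  \<comment> \<open>Each success comes from a step taken while the queries were infeasible, hence at
    a level of at most \<open>J\<close>.\<close>
  have "successes greedy I w \<subseteq> ?q ` (\<Union>j\<le>J. K j)"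
  proof
    fix i assume "i \<in> successes greedy I w"
    then obtain k where k: "k < ?n" "i = ?q k" "w i \<ge> (up I i + lo I i) / 2"
      unfolding successes_def asked_eq_image by auto
    have "level I w (queried greedy I w k) \<le> J"
      using level_le(1)[OF w infeasible_before_alg[OF k(1)] J(1)] .
    then have "k \<in> (\<Union>j\<le>J. K j)" using k by (auto simp: K_def)
    then show "i \<in> ?q ` (\<Union>j\<le>J. K j)" using k(2) by blast
  qed
  moreover have finK: "finite (K j)" for j
    by (rule finite_subset[of _ "{..<?n}"]) (auto simp: K_def)
  ultimately have "card (successes greedy I w) \<le> card (\<Union>j\<le>J. K j)"
    by (intro surj_card_le) auto
  also have "\<dots> \<le> (\<Sum>j\<le>J. card (K j))" by (intro card_UN_le) simp
  finally have "real (card (successes greedy I w)) \<le> (\<Sum>j\<le>J. real (card (K j)))"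
    by (metis of_nat_le_iff of_nat_sum)
  also have "\<dots> \<le> (\<Sum>j\<le>J. 2 ^ j * (5 * ?rho))"
  proof (intro sum_mono)
    fix j
    have "1 + 4 * 2 ^ j * L \<le> 2 ^ j * 1 + 4 * 2 ^ j * L" by simp
    also have "\<dots> = 2 ^ j * (1 + 4 * L)" by (simp add: algebra_simps)
    also have "\<dots> \<le> 2 ^ j * (5 * ?rho)" using L rho by (intro mult_left_mono) auto
    finally show "real (card (K j)) \<le> 2 ^ j * (5 * ?rho)" using K[of j] by linarith
  qed
  also have "\<dots> = (2 ^ Suc J - 1) * (5 * ?rho)"
    using geometric_sum[of "2::real" "Suc J"] by (simp add: sum_distrib_right[symmetric] lessThan_Suc_atMost)
  also have "\<dots> \<le> (4 * real (opt I w)) * (5 * ?rho)"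
  proof (intro mult_right_mono)
    have "real (2 ^ J) \<le> real (2 * opt I w)" using J(2) by (intro of_nat_mono) simp
    then show "2 ^ Suc J - 1 \<le> 4 * real (opt I w)" by simp
  qed (use rho in auto)
  finally show ?thesis by (simp add: mult_ac)
qed

end

context minset_problem
begin

lemma card_successes_le:
  assumes w: "realization I w" and m: "card (fam I) \<ge> 2"
  shows "real (card (successes greedy I w))
    \<le> 20 / ln 2 * (ln (real (card (fam I))) * rho_bar I (2 / s_min I)) * real (opt I w)"
proof (cases "alg greedy I w = 0")
  case True
  then have "successes greedy I w = {}" by (simp add: successes_def asked_def)
  \<comment> \<open>Without queries the optimum is \<open>0\<close>, so the right-hand side vanishes
    even where \<open>s_min I\<close> is unspecified.\<close>
  then show ?thesis using opt_0_if_alg_0[OF query_algorithm_greedy True] by simp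
next
  case False
  then have inf: "\<not> feasible I w {}" using infeasible_before_alg[of 0 greedy w] by simp
  then interpret nontrivial_minset_problem I
    by unfold_locales (rule nontrivial_if_infeasible[OF w])
  have "opt I w \<noteq> 0" using inf feasible_empty_if_opt_0 by blast
  then have "real (card (successes greedy I w)) \<le> 20 * rho_bar I (2 / s_min I) * real (opt I w)"
    using card_successes_le_nontrivial[OF w m] by simp
  also have "\<dots> \<le> (20 * rho_bar I (2 / s_min I) * real (opt I w)) * (ln (real (card (fam I))) / ln 2)"
  proof -
    \<comment> \<open>The factor \<open>ln m\<close> of the ratio enters here, at the price of the
      constant \<open>1 / ln 2\<close>.\<close>
    have "1 \<le> ln (real (card (fam I))) / ln 2" using m by (simp add: field_simps)
    moreover have "0 \<le> 20 * rho_bar I (2 / s_min I) * real (opt I w)"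
      using rho_bar_ge(1)[OF m] by simp
    ultimately show ?thesis
      using mult_left_mono[of 1 "ln (real (card (fam I))) / ln 2"
          "20 * rho_bar I (2 / s_min I) * real (opt I w)"] by simp
  qed
  finally show ?thesis by (simp add: mult_ac)
qed

section \<open>Asking an interval does not depend on its value\<close>

lemma feasible_cong:
  assumes "realization I w" "realization I w'" "\<And>i. i \<in> Q \<Longrightarrow> w i = w' i"
  shows "feasible I w Q \<longleftrightarrow> feasible I w' Q"
proof -
  have "lo_after I w Q = lo_after I w' Q" "up_after I w Q = up_after I w' Q"
    using assms(3) by (auto simp: lo_after_def up_after_def fun_eq_iff intro!: sum.cong)
  then show ?thesis using feasible_iff[OF assms(1)] feasible_iff[OF assms(2)] by simp
qed

text \<open>Until \<open>i\<close> is queried both runs see the same values, so their histories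
  agree. The changed run cannot stop earlier, since feasibility of a query set avoiding
  \<open>i\<close> does not depend on \<open>w i\<close>.\<close>

lemma asked_upd:
  assumes A: "query_algorithm A" and w: "realization I w" and w': "realization I (w(i := c))"
    and i: "i \<in> asked A I w"
  shows "i \<in> asked A I (w(i := c))"
proof -
  let ?w = "w(i := c)"
  obtain k where k: "k < alg A I w" "i = next_query A I w k" using i unfolding asked_eq_image by auto
  have new: "next_query A I w l \<noteq> i" if "l < k" for l
    using inj_on_next_query[OF A, of w] k that by (auto simp: inj_on_def)
  have hist: "l \<le> k \<Longrightarrow> history A I ?w l = history A I w l" for l
  proof (induction l)
    case 0
    then show ?case by simp
  next
    case (Suc l)
    then show ?case using new[of l] by (simp add: Let_def)
  qed
  have "k < alg A I ?w"
  proof (rule ccontr)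
    assume "\<not> k < alg A I ?w"
    then have le: "alg A I ?w \<le> k" by simp
    have eq: "asked A I ?w = queried A I w (alg A I ?w)" using hist[OF le] by (simp add: asked_def)
    have "i \<notin> queried A I w (alg A I ?w)"
      unfolding queried_eq_image using new[OF order_less_le_trans[OF _ le]] by auto
    then have "feasible I w (queried A I w (alg A I ?w)) \<longleftrightarrow> feasible I ?w (queried A I w (alg A I ?w))"
      by (intro feasible_cong[OF w w']) auto
    then have "feasible I w (queried A I w (alg A I ?w))"
      using feasible_asked[OF A, of ?w] unfolding eq by simp
    then show False using infeasible_before_alg[of "alg A I ?w" A w] le k(1) by simp
  qed
  then show ?thesis using hist[of k] k(2) unfolding asked_eq_image by force
qed

end

section \<open>Expected number of queries\<close>

lemma pred_borel_cmp:
  fixes f g :: "'a \<Rightarrow> real"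
  assumes [measurable]: "f \<in> borel_measurable N" "g \<in> borel_measurable N"
  shows "Measurable.pred N (\<lambda>w. f w \<le> g w)" "Measurable.pred N (\<lambda>w. f w < g w)"
    "Measurable.pred N (\<lambda>w. f w = g w)"
  by measurable

lemma borel_measurable_of_bool_pred:
  assumes [measurable]: "Measurable.pred N P"
  shows "(\<lambda>x. of_bool (P x) :: real) \<in> borel_measurable N"
  unfolding of_bool_def by measurable

lemma measurable_penalty:
  assumes [measurable]: "f \<in> borel_measurable N"
  shows "(\<lambda>x. penalty s (f x)) \<in> borel_measurable N"
  unfolding penalty_def by measurable

locale stochastic_minset_problem = minset_problem +
  fixes D :: "nat \<Rightarrow> real measure"
  assumes dist: "value_distributions I D"
begin

abbreviation M :: "(nat \<Rightarrow> real) measure" where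
  "M \<equiv> joint I D"

lemma prob_space_D: "i < num I \<Longrightarrow> prob_space (D i)"
  using dist by (simp add: value_distributions_def)

lemma sets_D: "i < num I \<Longrightarrow> sets (D i) = sets borel"
  using dist by (simp add: value_distributions_def)

sublocale joint: prob_space M
  unfolding joint_def by (rule prob_space_PiM) (simp add: prob_space_D)

lemma AE_realization: "AE w in M. realization I w"
proof -
  have "AE w in M. \<forall>i\<in>{..<num I}. w i \<in> ivl I i"
    unfolding joint_def using dist prob_space_D
    by (intro AE_finite_allI AE_PiM_component) (auto simp: value_distributions_def)
  then show ?thesis by (auto simp: realization_def elim: eventually_mono)
qed

lemma measurable_component: "(\<lambda>w. w i) \<in> borel_measurable M"
proof (cases "i < num I")
  case True
  then have "(\<lambda>w. w i) \<in> measurable M (D i)"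
    unfolding joint_def by (intro measurable_component_singleton) simp
  then show ?thesis using measurable_cong_sets[OF refl sets_D[OF True]] by blast
next
  case False
  \<comment> \<open>Points of the product space are extensional, so coordinates beyond
    \<open>num I\<close> are constant.\<close>
  then have "w i = undefined" if "w \<in> space M" for w
    using that by (auto simp: joint_def space_PiM PiE_def extensional_def)
  then show ?thesis by (subst measurable_cong[where g = "\<lambda>_. undefined"]) auto
qed

lemma measurable_lo_after: "(\<lambda>w. lo_after I w Q S) \<in> borel_measurable M"
  unfolding lo_after_def
  by (intro borel_measurable_add borel_measurable_sum borel_measurable_const measurable_component)

lemma measurable_up_after: "(\<lambda>w. up_after I w Q S) \<in> borel_measurable M"
  unfolding up_after_def
  by (intro borel_measurable_add borel_measurable_sum borel_measurable_const measurable_component)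

lemma measurable_w_star: "(\<lambda>w. w_star I w) \<in> borel_measurable M"
  unfolding w_star_def using finite_fam
  by (intro borel_measurable_Min borel_measurable_sum measurable_component)

lemma measurable_feasible: "Measurable.pred M (\<lambda>w. feasible I w Q)"
  unfolding feasible_def
  by (intro pred_intros_logic pred_intros_finite finite_fam pred_borel_cmp
      measurable_lo_after measurable_up_after measurable_w_star)

lemma measurable_opt: "(\<lambda>w. opt I w) \<in> measurable M (count_space UNIV)"
proof -
  \<comment> \<open>The minimum ranges over a set that varies with \<open>w\<close>; as a
    \<open>LEAST\<close> it involves, for each \<open>k\<close>, only finitely many feasibility
    events.\<close>
  have "opt I w = (LEAST k. \<exists>Q\<in>Pow {..<num I}. card Q = k \<and> feasible I w Q)" for w
  proof -
    have "card ` {Q. Q \<subseteq> {..<num I} \<and> feasible I w Q}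
        = {k. \<exists>Q\<in>Pow {..<num I}. card Q = k \<and> feasible I w Q}" by auto
    moreover have "finite (card ` {Q. Q \<subseteq> {..<num I} \<and> feasible I w Q})"
      by (rule finite_imageI, rule finite_subset[of _ "Pow {..<num I}"]) auto
    moreover have "\<exists>k. \<exists>Q\<in>Pow {..<num I}. card Q = k \<and> feasible I w Q"
      using feasible_all by blast
    ultimately show ?thesis unfolding opt_def by (simp only: Least_Min)
  qed
  moreover have "(\<lambda>w. LEAST k. \<exists>Q\<in>Pow {..<num I}. card Q = k \<and> feasible I w Q)
      \<in> measurable M (count_space UNIV)"
    by (intro measurable_Least pred_intros_finite pred_intros_logic) (auto simp: measurable_feasible)
  ultimately show ?thesis by presburger
qed

lemma measurable_target: "(\<lambda>w. target I w Q B) \<in> borel_measurable M"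
proof -
  have "(\<lambda>w. optimistic I w Q i) \<in> borel_measurable M" for i
    by (cases "i \<in> Q") (simp_all add: optimistic_def measurable_component)
  then have "(\<lambda>w. lo_after I (optimistic I w Q) P S) \<in> borel_measurable M" for P S
    unfolding lo_after_def
    by (intro borel_measurable_add borel_measurable_sum borel_measurable_const)
  then show ?thesis unfolding target_def using finite_fam finite_budget
    by (intro borel_measurable_Max borel_measurable_Min) simp_all
qed

lemma measurable_greedy_query:
  "(\<lambda>w. greedy_query I w Q) \<in> measurable M (count_space UNIV)"
proof -
  have deficit: "(\<lambda>w. deficit I w Q B S) \<in> borel_measurable M" for B S
    unfolding deficit_def by (intro borel_measurable_diff measurable_target measurable_lo_after)
  then have "(\<lambda>w. potential I w Q B) \<in> borel_measurable M" for B
    unfolding potential_def by (intro borel_measurable_sum measurable_penalty)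
  then have level: "(\<lambda>w. level I w Q) \<in> measurable M (count_space UNIV)"
    unfolding level_def by (intro measurable_Least pred_borel_cmp borel_measurable_const)
  have "(\<lambda>w. score I w Q B i) \<in> borel_measurable M" for B i
    unfolding score_def
    by (intro borel_measurable_sum borel_measurable_diff measurable_penalty deficit borel_measurable_const)
  \<comment> \<open>The budget is itself random, but takes countably many values, so measurability
    for each fixed budget suffices.\<close>
  then have "(\<lambda>w. score I w Q (2 ^ level I w Q) i) \<in> borel_measurable M" for i
    by (rule measurable_compose_countable[OF _ level, where f = "\<lambda>j w. score I w Q (2 ^ j) i"])
  then show ?thesis unfolding greedy_query_def
    by (intro measurable_Least pred_intros_logic pred_intros_countable pred_borel_cmp) simp_all
qed

text \<open>On each of the countably many values of the index list so far, the next query is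
  \<open>greedy_query\<close> at a fixed set.\<close>

lemma measurable_queries:
  "(\<lambda>w. map fst (history greedy I w k)) \<in> measurable M (count_space UNIV)"
proof (induction k)
  case 0
  then show ?case by simp
next
  case (Suc k)
  have "map fst (history greedy I w (Suc k)) = map fst (history greedy I w k) @
      [greedy_query I w (set (map fst (history greedy I w k)))]" for w
    using next_query_greedy[of I w k] by (simp add: Let_def)
  moreover have "(\<lambda>w. map fst (history greedy I w k) @
      [greedy_query I w (set (map fst (history greedy I w k)))]) \<in> measurable M (count_space UNIV)"
    by (rule measurable_compose_countable[OF _ Suc.IH, where f = "\<lambda>is w. is @ [greedy_query I w (set is)]"])
      (rule measurable_compose[OF measurable_greedy_query], simp)
  ultimately show ?case by presburger
qed

lemma measurable_alg: "(\<lambda>w. alg greedy I w) \<in> measurable M (count_space UNIV)"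
proof -
  have "Measurable.pred M (\<lambda>w. feasible I w (set (map fst (history greedy I w k))))" for k
    by (rule measurable_compose_countable[OF measurable_feasible measurable_queries])
  then show ?thesis unfolding alg_def by (intro measurable_Least) simp
qed

lemma measurable_asked: "Measurable.pred M (\<lambda>w. i \<in> asked greedy I w)"
proof -
  have "Measurable.pred M (\<lambda>w. i \<in> set (map fst (history greedy I w k)))" for k
    by (rule measurable_compose[OF measurable_queries]) simp
  then have "Measurable.pred M (\<lambda>w. i \<in> set (map fst (history greedy I w (alg greedy I w))))"
    by (rule measurable_compose_countable[OF _ measurable_alg])
  then show ?thesis by (simp add: asked_def)
qed

lemma measurable_successes: "Measurable.pred M (\<lambda>w. i \<in> successes greedy I w)"
  unfolding successes_def mem_Collect_eq
  by (intro pred_intros_logic measurable_asked pred_borel_cmp borel_measurable_const measurable_component)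

section \<open>Independence and expectations\<close>

lemma integral_mult_indicator_indep:
  fixes g :: "(nat \<Rightarrow> real) \<Rightarrow> real"
  assumes i: "i < num I" and g: "integrable M g" and indep: "\<And>w y. g (w(i := y)) = g w"
    and X: "X \<in> sets borel"
  shows "(\<integral>w. g w * indicator X (w i) \<partial>M) = measure (D i) X * (\<integral>w. g w \<partial>M)"
proof -
  \<comment> \<open>Fubini needs a family that is sigma-finite at every index, and \<open>D\<close>
    is arbitrary beyond \<open>num I\<close>; point masses fill the gap.\<close>
  define D' where "D' k = (if k < num I then D k else return borel 0)" for k
  interpret product_sigma_finite D'
    unfolding product_sigma_finite_def D'_def using prob_space_D
    by (auto intro!: prob_space_return prob_space_imp_sigma_finite)
  let ?J = "{..<num I} - {i}"
  have M: "M = PiM (insert i ?J) D'"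
    unfolding joint_def using i by (intro PiM_cong) (auto simp: D'_def)
  have Di: "D' i = D i" using i by (simp add: D'_def)
  interpret Di: prob_space "D i" using i by (rule prob_space_D)
  have Xi: "X \<in> sets (D i)" using X sets_D[OF i] by simp
  have "(\<lambda>w. indicator X (w i) :: real) \<in> borel_measurable M"
    using measurable_component X by (rule measurable_compose[OF _ borel_measurable_indicator])
  then have gX: "integrable M (\<lambda>w. g w * indicator X (w i))"
    using g by (intro Bochner_Integration.integrable_bound[OF g]) (auto simp: indicator_def)
  have "(\<integral>w. g w * indicator X (w i) \<partial>M) = (\<integral>x. (\<integral>y. g x * indicator X y \<partial>D i) \<partial>PiM ?J D')"
    using product_integral_insert[of ?J i, OF _ _ gX[unfolded M]] by (simp add: M indep Di)
  also have "\<dots> = measure (D i) X * (\<integral>x. g x \<partial>PiM ?J D')"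
    using Xi by (simp add: mult.commute)
  \<comment> \<open>Fubini again without the indicator: integrating out coordinate \<open>i\<close>
    gives the factor \<open>1\<close>.\<close>
  also have "(\<integral>x. g x \<partial>PiM ?J D') = (\<integral>w. g w \<partial>M)"
    using product_integral_insert[of ?J i, OF _ _ g[unfolded M]]
    by (simp add: M indep Di Di.prob_space)
  finally show ?thesis .
qed

lemma integrable_bounded_nat:
  assumes "f \<in> measurable M (count_space UNIV)" "\<And>w. f w \<le> (b::nat)"
  shows "integrable M (\<lambda>w. real (f w))"
  using assms by (intro joint.integrable_const_bound[where B = "real b"]) auto

text \<open>Being asked is known to be insensitive to \<open>w i\<close> among realizations only.
  Overwriting coordinate \<open>i\<close> by the midpoint \<open>c\<close> yields \<open>g\<close>,
  which ignores \<open>w i\<close> everywhere and agrees with the event almost surely. So the event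
  that \<open>w i\<close> is large factors out, with probability at least
  \<open>tau I D\<close>.\<close>

lemma tau_mult_prob_asked_le:
  assumes i: "i < num I"
  shows "tau I D * (\<integral>w. of_bool (i \<in> asked greedy I w) \<partial>M)
    \<le> (\<integral>w. of_bool (i \<in> successes greedy I w) \<partial>M)"
proof -
  define c where "c = (lo I i + up I i) / 2"
  define X where "X = {x. x \<ge> (up I i + lo I i) / 2}"
  define g :: "(nat \<Rightarrow> real) \<Rightarrow> real" where "g w = of_bool (i \<in> asked greedy I (w(i := c)))" for w
  have c: "c \<in> ivl I i" using lo_le_up[OF i] by (auto simp: c_def ivl_def)
  have X: "X \<in> sets borel" unfolding X_def by measurable
  have "(\<lambda>w. w(i := c)) \<in> measurable M M"
  proof -
    have ins: "insert i {..<num I} = {..<num I}" using i by auto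
    have "c \<in> space (D i)" using sets_eq_imp_space_eq[OF sets_D[OF i]] by simp
    then have "(\<lambda>w. (w, c)) \<in> measurable M (M \<Otimes>\<^sub>M D i)" by (intro measurable_Pair) auto
    from measurable_compose[OF this[unfolded joint_def] measurable_add_dim]
    show ?thesis by (simp add: joint_def ins)
  qed
  then have "Measurable.pred M (\<lambda>w. i \<in> asked greedy I (w(i := c)))"
    using measurable_asked by (rule measurable_compose)
  then have g_meas: "g \<in> borel_measurable M"
    unfolding g_def by (rule borel_measurable_of_bool_pred)
  then have g: "integrable M g"
    by (intro joint.integrable_const_bound[where B = 1]) (auto simp: g_def)
  have "g w = of_bool (i \<in> asked greedy I w)" if w: "realization I w" for w
  proof -
    have w': "realization I (w(i := c))" using w c by (simp add: realization_def)
    \<comment> \<open>Restoring \<open>w i\<close> gives back \<open>w\<close>, so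
      \<open>asked_upd\<close> applies in both directions.\<close>
    have "realization I ((w(i := c))(i := w i))" using w by simp
    then have "i \<in> asked greedy I (w(i := c)) \<longleftrightarrow> i \<in> asked greedy I w"
      using asked_upd[OF query_algorithm_greedy w w'] asked_upd[OF query_algorithm_greedy w']
      by (metis fun_upd_triv fun_upd_upd)
    then show ?thesis by (simp add: g_def)
  qed
  then have AE: "AE w in M. g w = of_bool (i \<in> asked greedy I w)"
    using AE_realization by (auto elim: eventually_mono)
  have "tau I D \<le> measure (D i) X"
    unfolding tau_def X_def using i by (intro Min_le) auto
  then have "tau I D * (\<integral>w. g w \<partial>M) \<le> measure (D i) X * (\<integral>w. g w \<partial>M)"
    by (intro mult_right_mono integral_nonneg) (auto simp: g_def)
  also have "\<dots> = (\<integral>w. g w * indicator X (w i) \<partial>M)"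
    by (rule integral_mult_indicator_indep[symmetric, OF i g _ X]) (simp add: g_def)
  also have "\<dots> = (\<integral>w. of_bool (i \<in> successes greedy I w) \<partial>M)"
  proof (rule integral_cong_AE)
    show "(\<lambda>w. g w * indicator X (w i)) \<in> borel_measurable M"
      using measurable_compose[OF measurable_component borel_measurable_indicator[OF X]] g_meas
      by (intro borel_measurable_times)
    show "(\<lambda>w. of_bool (i \<in> successes greedy I w) :: real) \<in> borel_measurable M"
      by (intro borel_measurable_of_bool_pred measurable_successes)
    show "AE w in M. g w * indicator X (w i) = of_bool (i \<in> successes greedy I w)"
      using AE by eventually_elim (auto simp: successes_def X_def)
  qed
  also have "(\<integral>w. g w \<partial>M) = (\<integral>w. of_bool (i \<in> asked greedy I w) \<partial>M)"
    using g_meas AE by (intro integral_cong_AE borel_measurable_of_bool_pred measurable_asked)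
  finally show ?thesis .
qed

text \<open>Linearity of expectation: both counts are sums of indicators over the intervals.\<close>

lemma tau_mult_expected_alg_le:
  "tau I D * (\<integral>w. real (alg greedy I w) \<partial>M) \<le> (\<integral>w. real (card (successes greedy I w)) \<partial>M)"
    "integrable M (\<lambda>w. real (card (successes greedy I w)))"
proof -
  note A = query_algorithm_greedy
  have card_sum: "real (card Y) = (\<Sum>i<num I. of_bool (i \<in> Y))" if "Y \<subseteq> {..<num I}" for Y
    using that by (simp add: Int_absorb1 of_bool_def sum.If_cases)
  have alg: "real (alg greedy I w) = (\<Sum>i<num I. of_bool (i \<in> asked greedy I w))" for w
    using card_sum[OF asked_subset_card(1)[OF A]] asked_subset_card(2)[OF A, of w] by simp
  have succ: "real (card (successes greedy I w)) = (\<Sum>i<num I. of_bool (i \<in> successes greedy I w))" for w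
    using asked_subset_card(1)[OF A, of w] by (intro card_sum) (auto simp: successes_def)
  have int: "integrable M (\<lambda>w. of_bool (i \<in> asked greedy I w) :: real)"
    "integrable M (\<lambda>w. of_bool (i \<in> successes greedy I w) :: real)" for i
    by (auto intro!: joint.integrable_const_bound[where B = 1] borel_measurable_of_bool_pred
        measurable_asked measurable_successes)
  show "integrable M (\<lambda>w. real (card (successes greedy I w)))"
    unfolding succ by (intro Bochner_Integration.integrable_sum int)
  show "tau I D * (\<integral>w. real (alg greedy I w) \<partial>M) \<le> (\<integral>w. real (card (successes greedy I w)) \<partial>M)"
    unfolding succ alg
    by (subst (1 2) Bochner_Integration.integral_sum)
      (auto simp: int sum_distrib_left intro!: sum_mono tau_mult_prob_asked_le)
qed

lemma competitive_greedy:
  assumes m: "card (fam I) \<ge> 2" and tau: "tau I D > 0"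
  shows "competitive greedy I D
    (20 / ln 2 * (1 / tau I D * ln (real (card (fam I))) * rho_bar I (2 / s_min I)))"
proof -
  let ?r = "20 / ln 2 * (ln (real (card (fam I))) * rho_bar I (2 / s_min I))"
  have opt: "integrable M (\<lambda>w. real (opt I w))"
    using opt_le by (intro integrable_bounded_nat measurable_opt)
  have "tau I D * (\<integral>w. real (alg greedy I w) \<partial>M) \<le> (\<integral>w. real (card (successes greedy I w)) \<partial>M)"
    by (rule tau_mult_expected_alg_le)
  also have "\<dots> \<le> (\<integral>w. ?r * real (opt I w) \<partial>M)"
    using AE_realization card_successes_le[OF _ m]
    by (intro integral_mono_AE tau_mult_expected_alg_le integrable_mult_right opt)
      (auto elim!: eventually_mono)
  also have "\<dots> = ?r * (\<integral>w. real (opt I w) \<partial>M)" by simp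
  finally have "(\<integral>w. real (alg greedy I w) \<partial>M) \<le> ?r * (\<integral>w. real (opt I w) \<partial>M) / tau I D"
    unfolding pos_le_divide_eq[OF tau] by (simp only: mult.commute)
  moreover have "integrable M (\<lambda>w. real (alg greedy I w))"
    using alg_le[OF query_algorithm_greedy] by (intro integrable_bounded_nat measurable_alg)
  ultimately show ?thesis unfolding competitive_def by (simp add: mult_ac)
qed

end

section \<open>From \<open>rho_bar\<close> to the squared logarithm\<close>

lemma competitive_mono:
  assumes "competitive A I D r" "r \<le> r'"
  shows "competitive A I D r'"
proof -
  have "r * (\<integral>w. real (opt I w) \<partial>joint I D) \<le> r' * (\<integral>w. real (opt I w) \<partial>joint I D)"
    using assms(2) by (intro mult_right_mono integral_nonneg) auto
  then show ?thesis using assms(1) unfolding competitive_def by linarith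
qed

text \<open>Each ceiling costs at most \<open>1\<close>. The maximum with \<open>1\<close> makes
  \<open>ln ?c\<close> nonnegative, so the constant \<open>2 + ln ?c\<close> may be multiplied by
  \<open>ln ?m / ln 2 \<ge> 1\<close>.\<close>

lemma rho_bar_le_ln:
  assumes inst: "minset_instance I" and m: "card (fam I) \<ge> 2"
    and s: "0 < s" "s \<le> s_min I" and b: "max_gap I \<le> b"
  shows "rho_bar I (2 / s_min I) \<le> (2 + (2 + ln (max 1 (2 / s * b))) / ln 2) * ln (real (card (fam I)))"
proof -
  interpret minset_problem I by unfold_locales (rule inst)
  let ?m = "real (card (fam I))" and ?c = "max 1 (2 / s * b)"
  have m2: "?m \<ge> 2" using m by linarith
  then have lnm: "ln ?m \<ge> ln 2" by simp
  obtain S where S: "S \<in> fam I" using fam_nonempty by blast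
  have gap: "max_gap I \<ge> 0"
  proof -
    have "up_set I S - lo_set I S \<le> max_gap I" using max_gap_ge[OF S S] .
    moreover have "lo_set I S \<le> up_set I S"
      unfolding lo_set_def up_set_def using fam_subset[OF S] lo_le_up by (intro sum_mono) auto
    ultimately show ?thesis by linarith
  qed
  have "2 / s_min I * max_gap I \<le> 2 / s * b"
    using s b gap by (intro mult_mono divide_left_mono) auto
  then have "2 / s_min I * max_gap I \<le> ?c" by linarith
  then have le: "2 / s_min I * ?m * max_gap I \<le> ?c * ?m"
    using mult_right_mono[of "2 / s_min I * max_gap I" ?c ?m] by (simp add: mult_ac)
  have "ln (2 / s_min I * ?m * max_gap I) \<le> ln (?c * ?m)"
  proof (cases "2 / s_min I * ?m * max_gap I > 0")
    case True
    then show ?thesis using le by (intro ln_mono) auto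
  next
    case False
    moreover have "2 / s_min I * ?m * max_gap I \<ge> 0"
      using gap s by (intro mult_nonneg_nonneg) auto
    ultimately have "2 / s_min I * ?m * max_gap I = 0" by linarith
    \<comment> \<open>A vanishing argument is harmless because \<open>ln 0\<close> is
      \<open>0\<close> by convention.\<close>
    then have "ln (2 / s_min I * ?m * max_gap I) = 0" by (simp only: ln_0)
    moreover have "1 * 1 \<le> ?c * ?m" using m2 by (intro mult_mono) auto
    then have "0 \<le> ln (?c * ?m)" by (intro ln_ge_zero) simp
    ultimately show ?thesis by linarith
  qed
  also have "\<dots> = ln ?c + ln ?m" using m2 by (intro ln_mult_pos) auto
  finally have "rho_bar I (2 / s_min I) \<le> (ln ?c + ln ?m + 1) + (ln ?m + 1)"
    unfolding rho_bar_def of_int_add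
    using of_int_ceiling_le_add_one[of "ln (2 / s_min I * ?m * max_gap I)"]
      of_int_ceiling_le_add_one[of "ln ?m"] by linarith
  also have "\<dots> = 2 * ln ?m + (2 + ln ?c) * 1" by simp
  also have "\<dots> \<le> 2 * ln ?m + (2 + ln ?c) * (ln ?m / ln 2)"
    using lnm by (intro add_left_mono mult_left_mono) (auto simp: field_simps)
  also have "\<dots> = (2 + (2 + ln ?c) / ln 2) * ln ?m" by (simp add: distrib_right)
  finally show ?thesis .
qed

text \<open>One algorithm serves all instances. The first constant is universal; the second depends
  only on \<open>s\<close> and \<open>b\<close>, which express that interval limits count as
  constants. For \<open>m = 1\<close> the factor \<open>ln m\<close> vanishes although queries may
  be necessary, so \<open>m \<ge> 2\<close> is assumed.\<close>

theorem theorem9: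
  shows "\<exists>A. query_algorithm A \<and>
    (\<exists>C>0. \<forall>I D.
       minset_instance I \<and> card (fam I) \<ge> 2 \<and> value_distributions I D \<and> tau I D > 0 \<longrightarrow>
       competitive A I D
         (C * (1 / tau I D * ln (real (card (fam I))) * rho_bar I (2 / s_min I)))) \<and>
    (\<forall>s>0. \<forall>b. \<exists>C>0. \<forall>I D.
       minset_instance I \<and> card (fam I) \<ge> 2 \<and> value_distributions I D \<and> tau I D > 0 \<and>
       s_min I \<ge> s \<and> max_gap I \<le> b \<longrightarrow>
       1 / tau I D * ln (real (card (fam I))) * rho_bar I (2 / s_min I)
         \<le> C * (1 / tau I D * (ln (real (card (fam I))))\<^sup>2) \<and>
       competitive A I D (C * (1 / tau I D * (ln (real (card (fam I))))\<^sup>2)))"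
proof (intro exI[of _ greedy] conjI allI impI)
  show "query_algorithm greedy" by (rule query_algorithm_greedy)
  have comp: "competitive greedy I D
      (20 / ln 2 * (1 / tau I D * ln (real (card (fam I))) * rho_bar I (2 / s_min I)))"
    if "minset_instance I" "card (fam I) \<ge> 2" "value_distributions I D" "tau I D > 0" for I D
  proof -
    interpret stochastic_minset_problem I D using that by unfold_locales
    show ?thesis using competitive_greedy that by blast
  qed
  then show "\<exists>C>0. \<forall>I D.
      minset_instance I \<and> card (fam I) \<ge> 2 \<and> value_distributions I D \<and> tau I D > 0 \<longrightarrow>
      competitive greedy I D
        (C * (1 / tau I D * ln (real (card (fam I))) * rho_bar I (2 / s_min I)))"
    by (intro exI[of _ "20 / ln 2"]) auto
  fix s b :: real
  assume s: "s > 0"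
  define K where "K = 2 + (2 + ln (max 1 (2 / s * b))) / ln 2"
  have K: "K > 0" unfolding K_def by (intro add_pos_nonneg divide_nonneg_pos add_nonneg_nonneg) auto
  \<comment> \<open>The sum of the two constants required, so that one \<open>C\<close> serves both
    the comparison of the bounds and the ratio.\<close>
  define C where "C = K + 20 / ln 2 * K"
  have "1 / tau I D * ln (real (card (fam I))) * rho_bar I (2 / s_min I)
        \<le> C * (1 / tau I D * (ln (real (card (fam I))))\<^sup>2) \<and>
      competitive greedy I D (C * (1 / tau I D * (ln (real (card (fam I))))\<^sup>2))"
    if asm: "minset_instance I" "card (fam I) \<ge> 2" "value_distributions I D" "tau I D > 0"
      "s_min I \<ge> s" "max_gap I \<le> b" for I D
  proof -
    let ?l = "ln (real (card (fam I)))"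
    have pos: "0 \<le> 1 / tau I D * ?l" using asm by auto
    have "rho_bar I (2 / s_min I) \<le> K * ?l"
      unfolding K_def using rho_bar_le_ln asm s by blast
    from mult_left_mono[OF this pos]
    have le: "1 / tau I D * ?l * rho_bar I (2 / s_min I) \<le> K * (1 / tau I D * ?l\<^sup>2)"
      by (simp add: power2_eq_square mult_ac)
    have nonneg: "0 \<le> K * (1 / tau I D * ?l\<^sup>2)" using K asm by simp
    have CK: "C * (1 / tau I D * ?l\<^sup>2) = K * (1 / tau I D * ?l\<^sup>2) + 20 / ln 2 * (K * (1 / tau I D * ?l\<^sup>2))"
      by (simp add: C_def algebra_simps)
    have "20 / ln 2 * (1 / tau I D * ?l * rho_bar I (2 / s_min I)) \<le> 20 / ln 2 * (K * (1 / tau I D * ?l\<^sup>2))"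
      using le by (intro mult_left_mono) auto
    then have "20 / ln 2 * (1 / tau I D * ?l * rho_bar I (2 / s_min I)) \<le> C * (1 / tau I D * ?l\<^sup>2)"
      using nonneg unfolding CK by linarith
    then have "competitive greedy I D (C * (1 / tau I D * ?l\<^sup>2))"
      using competitive_mono comp[OF asm(1-4)] by blast
    moreover have "0 \<le> 20 / ln 2 * (K * (1 / tau I D * ?l\<^sup>2))"
      by (rule mult_nonneg_nonneg[OF _ nonneg]) simp
    then have "K * (1 / tau I D * ?l\<^sup>2) \<le> C * (1 / tau I D * ?l\<^sup>2)" unfolding CK by linarith
    ultimately show ?thesis using le by linarith
  qed
  moreover have "C > 0" unfolding C_def using K by (intro add_pos_pos mult_pos_pos) auto
  ultimately show "\<exists>C>0. \<forall>I D.
       minset_instance I \<and> card (fam I) \<ge> 2 \<and> value_distributions I D \<and> tau I D > 0 \<and>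
       s_min I \<ge> s \<and> max_gap I \<le> b \<longrightarrow>
       1 / tau I D * ln (real (card (fam I))) * rho_bar I (2 / s_min I)
         \<le> C * (1 / tau I D * (ln (real (card (fam I))))\<^sup>2) \<and>
       competitive greedy I D (C * (1 / tau I D * (ln (real (card (fam I))))\<^sup>2))"
    by (intro exI[of _ C]) blast
qed

end
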